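(* (Compression principle) Let $V$ be a unitary VOA of CFT type, $\mathfrak g$ a unitary simple Lie subalgebra of $V(1)$, and $l$ the level of $\mathfrak g$ in $V$. Let $W_i,W_j,W_k$ be unitary representations of $V$. Assume that $w_\lambda$ (resp. $w_\mu$, $w_\nu$) is a non-zero homogeneous highest weight vector of $\hat{\mathfrak g}\curvearrowright W_i$ (resp. $\hat{\mathfrak g}\curvearrowright W_j$, $\hat{\mathfrak g}\curvearrowright W_k$) with highest weight $\lambda$ (resp. $\mu$, $\nu$), and choose isometric $\mathfrak g$-module homomorphisms $\varphi_\lambda:L_{\mathfrak g}(\lambda)\to W_i$ (resp. $\varphi_\mu:L_{\mathfrak g}(\mu)\to W_j$, $\varphi_\nu:L_{\mathfrak g}(\nu)\to W_k$) with image $\mathfrak gw_\lambda$ (resp. $\mathfrak gw_\mu$, $\mathfrak gw_\nu$). Let $\varphi_\nu^\dagger:W_k\to L_{\mathfrak g}(\nu)$ be the formal adjoint of $\varphi_\nu$, i.e. $\langle\varphi_\nu u|w\rangle=\langle u|\varphi_\nu^\dagger w\rangle$ for all $u\in L_{\mathfrak g}(\nu)$, $w\in W_k$. Suppose there exist $s\in\mathbb R$ and a type ${k\choose i~j}$ intertwining operator $\mathfrak Y$ of $V$ such that the map $$\varphi_\nu^\dagger\mathfrak Y(\varphi_\lambda,s)\varphi_\mu:L_{\mathfrak g}(\lambda)\otimes L_{\mathfrak g}(\mu)\to L_{\mathfrak g}(\nu),\qquad u^{(\lambda)}\otimes u^{(\mu)}\mapsto\varphi_\nu^\dagger\mathfrak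 Y(\varphi_\lambda u^{(\lambda)},s)\varphi_\mu u^{(\mu)}$$ is non-zero. Then $\varphi_\nu^\dagger\mathfrak Y(\varphi_\lambda,s)\varphi_\mu\in\mathrm{Hom}_{\mathfrak g}(\lambda\otimes\mu,\nu)$, and there exists a type ${\nu\choose\lambda~\mu}$ intertwining operator $\mathcal Y$ of $V^l_{\mathfrak g}$ such that $$\Psi\mathcal Y=\varphi_\nu^\dagger\mathfrak Y(\varphi_\lambda,s)\varphi_\mu .$$ If, moreover, $u^{(\lambda)}\in L_{\mathfrak g}(\lambda)$ and $\mathfrak Y(\varphi_\lambda u^{(\lambda)},x)$ satisfies $r$-th order energy bounds for some $r\ge0$, then $\mathcal Y(u^{(\lambda)},x)$ also satisfies $r$-th order energy bounds.
   Context: **Unitary VOAs.** A VOA $V$ (vertex operator $Y(v,x)=\sum_nY(v,n)x^{-n-1}$, vacuum $\Omega$, conformal vector $\omega$, $L_n=Y(\omega,n+1)$) is of CFT type if its $L_0$-grading is $V=\bigoplus_{n\ge0}V(n)$ with $V(0)=\mathbb C\Omega$. It is unitary if there are an antilinear automorphism $\Theta$ (fixing $\Omega,\omega$, with $\Theta Y(v,x)=Y(\Theta v,x)\Theta$) and an inner product $\langle\cdot|\cdot\rangle$ (antilinear in the second variable, $\langle\Omega|\Omega\rangle=1$) with $\langle Y(v,x)v_1|v_2\rangle=\langle v_1|Y(e^{xL_1}(-x^{-2})^{L_0}\Theta v,x^{-1})v_2\rangle$. A $V$-module $(W_i,Y_i)$ with an inner product is unitary if the same identity holds for $Y_i$.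 Homogeneous means eigenvector of $L_0$. **Lie subalgebras of $V(1)$.** $V(1)$ is a Lie algebra with $[u,v]=Y(u,0)v$, $v^*=-\Theta v$, and invariant inner product $\langle\cdot|\cdot\rangle$ ($\langle[u,v]|w\rangle=\langle v|[u^*,w]\rangle$). A unitary simple Lie subalgebra $\mathfrak g\subset V(1)$ is a simple complex Lie subalgebra with $\mathfrak g^*=\mathfrak g$. Let $\mathfrak h$ be a $*$-stable Cartan subalgebra of $\mathfrak g$ and $(\cdot|\cdot)$ the normalized invariant inner product on $\mathfrak g$ (longest roots of length $\sqrt2$). The level $l$ of $\mathfrak g$ in $V$ is defined by $\langle X|Y\rangle=l(X|Y)$ for $X,Y\in\mathfrak g$; it is a non-negative integer. **Affine algebra.** $\hat{\mathfrak g}=\mathfrak g\otimes\mathbb C[t,t^{-1}]\oplus\mathbb CK$, $X(n)=X\otimes t^n$, $K$ central, $[X(m),Y(n)]=[X,Y](m+n)+m(X|Y^* )\delta_{m,-n}K$, $X(n)^*=X^*(-n)$, $K^*=K$. On any unitary $V$-module $W_i$, $\hat{\mathfrak g}$ acts by $X(n)\mapsto Y_i(X,n)$, $K\mapsto l$; $\mathfrak g$ acts via $X=X(0)$. A highest weight vector with highest weight $\lambda$ is a nonzero vector $w$ with $X(0)w=0$ for $X$ in a positive root space, $X(n)w=0$ for $X\in\mathfrak g,n>0$, and $Hw=\langle\lambda,H\rangle w$ for $H\in\mathfrak h$. $\mathfrak gw$ and $\hat{\mathfrak g}w$ denote the $\mathfrak g$-submodule, resp. $\hat{\mathfrak g}$-submodule,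 generated by $w$. **Affine VOA.** With $\theta$ the highest root, a dominant integral weight $\lambda$ is admissible at level $l$ if $(\lambda|\theta)\le l$ (the highest weight of any homogeneous highest weight vector for the action of $\hat{\mathfrak g}$, with $K\mapsto l$, on a unitary $V$-module is automatically dominant integral and admissible at level $l$). $L_{\mathfrak g}(\lambda)$ is the irreducible unitary $\mathfrak g$-module of highest weight $\lambda$; $L_{\mathfrak g}(\lambda,l)$ is the irreducible unitary positive energy $\hat{\mathfrak g}$-module with $K=l$ and lowest energy subspace $L_{\mathfrak g}(\lambda)$; $V^l_{\mathfrak g}=L_{\mathfrak g}(0,l)$ is the unitary affine VOA with $Y(X(-1)\Omega,x)=\sum_nX(n)x^{-n-1}$ and Sugawara conformal vector, and $L_{\mathfrak g}(\lambda,l)$ is a unitary $V^l_{\mathfrak g}$-module via $Y_\lambda(X(-1)\Omega,x)=\sum_nX(n)x^{-n-1}$. $\Delta_\lambda$ is the lowest $L_0$-eigenvalue on $L_{\mathfrak g}(\lambda,l)$ for the Virasoro action of $V^l_{\mathfrak g}$. $\mathrm{Hom}_{\mathfrak g}(\lambda\otimes\mu,\nu)=\mathrm{Hom}_{\mathfrak g}(L_{\mathfrak g}(\lambda)\otimes L_{\mathfrak g}(\mu),L_{\mathfrak g}(\nu))$. **Intertwining operators.** A type ${k\choose i~j}$ intertwining operator of $V$ is a linear map $w\mapsto\mathcal Y(w,x)=\sum_{s\in\mathbb R}\mathcal Y(w,s)x^{-s-1}$ from $W_i$ with $\mathcal Y(w,s)\in\mathrm{Hom}(W_j,W_k)$,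 satisfying lower truncation, the Jacobi identity, and $\mathcal Y(L_{-1}w,x)=\frac d{dx}\mathcal Y(w,x)$; type ${\nu\choose\lambda~\mu}$ for $V^l_{\mathfrak g}$ means $W_i,W_j,W_k=L_{\mathfrak g}(\lambda,l),L_{\mathfrak g}(\mu,l),L_{\mathfrak g}(\nu,l)$. For such $\mathcal Y$, $\Psi\mathcal Y\in\mathrm{Hom}_{\mathfrak g}(\lambda\otimes\mu,\nu)$ is $u^{(\lambda)}\otimes u^{(\mu)}\mapsto\mathcal Y(u^{(\lambda)},\Delta_\lambda+\Delta_\mu-\Delta_\nu-1)u^{(\mu)}$. **Energy bounds.** For homogeneous $w$ and $r\ge0$, $\mathcal Y(w,x)$ satisfies $r$-th order energy bounds if there are $M,t\ge0$ with $\|\mathcal Y(w,s)w'\|\le M(1+|s|)^t\|(1+L_0)^rw'\|$ for all $s\in\mathbb R$ and all $w'$ in the source space $W_j$ ($L_0$ being that of the VOA in question). *)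

theory Defs
  imports "HOL-Analysis.Analysis" "HOL-Library.Groups_Big_Fun"
begin

section \<open>Complex vector spaces with extra structure\<close>

text \<open>The underlying additive group is a whole type; complex scalar multiplication, inner product
  and vertex operators are record fields.\<close>

record 'w ispace =
  smult :: "complex \<Rightarrow> 'w \<Rightarrow> 'w"
  iprod :: "'w \<Rightarrow> 'w \<Rightarrow> complex"

definition inner_product_on ::
    "(complex \<Rightarrow> 'w::ab_group_add \<Rightarrow> 'w) \<Rightarrow> 'w set \<Rightarrow> ('w \<Rightarrow> 'w \<Rightarrow> complex) \<Rightarrow> bool" where
  "inner_product_on sm S f \<longleftrightarrow>
     (\<forall>u\<in>S. \<forall>v\<in>S. \<forall>w\<in>S. f (u + v) w = f u w + f v w) \<and>
     (\<forall>a. \<forall>u\<in>S. \<forall>v\<in>S. f (sm a u) v = a * f u v) \<and>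
     (\<forall>u\<in>S. \<forall>v\<in>S. f v u = cnj (f u v)) \<and>
     (\<forall>u\<in>S. u \<noteq> 0 \<longrightarrow> Re (f u u) > 0)"

definition vnorm :: "('w, 'z) ispace_scheme \<Rightarrow> 'w \<Rightarrow> real" where
  "vnorm W w = sqrt (Re (iprod W w w))"

definition linear_on ::
    "(complex \<Rightarrow> 'a::ab_group_add \<Rightarrow> 'a) \<Rightarrow> (complex \<Rightarrow> 'b::ab_group_add \<Rightarrow> 'b) \<Rightarrow> 'a set \<Rightarrow> ('a \<Rightarrow> 'b) \<Rightarrow> bool" where
  "linear_on sa sb S f \<longleftrightarrow>
     (\<forall>u\<in>S. \<forall>v\<in>S. f (u + v) = f u + f v) \<and> (\<forall>c. \<forall>u\<in>S. f (sa c u) = sb c (f u))"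

definition fin_dim :: "(complex \<Rightarrow> 'w::ab_group_add \<Rightarrow> 'w) \<Rightarrow> 'w set \<Rightarrow> bool" where
  "fin_dim sm S \<longleftrightarrow> (\<exists>B. finite B \<and> S \<subseteq> module.span sm B)"

definition eigenspace :: "(complex \<Rightarrow> 'w \<Rightarrow> 'w) \<Rightarrow> ('w \<Rightarrow> 'w) \<Rightarrow> complex \<Rightarrow> 'w set" where
  "eigenspace sm T a = {w. T w = sm a w}"

text \<open>\<open>is_decomposition E f w\<close>: \<open>w\<close> is the finite sum of the components \<open>f i \<in> E i\<close>.\<close>

definition is_decomposition :: "('i \<Rightarrow> 'w::ab_group_add set) \<Rightarrow> ('i \<Rightarrow> 'w) \<Rightarrow> 'w \<Rightarrow> bool" where
  "is_decomposition E f w \<longleftrightarrow>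
     (\<forall>i. f i \<in> E i) \<and> finite {i. f i \<noteq> 0} \<and> w = Sum_any f"

definition internal_direct_sum ::
    "(complex \<Rightarrow> 'w::ab_group_add \<Rightarrow> 'w) \<Rightarrow> ('i \<Rightarrow> 'w set) \<Rightarrow> bool" where
  "internal_direct_sum sm E \<longleftrightarrow>
     (\<forall>i. module.subspace sm (E i)) \<and> (\<forall>w. \<exists>!f. is_decomposition E f w)"

definition component :: "('i \<Rightarrow> 'w::ab_group_add set) \<Rightarrow> 'w \<Rightarrow> 'i \<Rightarrow> 'w" where
  "component E w = (THE f. is_decomposition E f w)"


section \<open>Vertex operator algebras, modules, intertwining operators\<close>

text \<open>\<open>vop V u n\<close> is the mode $Y(u,n)$, i.e. the coefficient of $x^{-n-1}$ in $Y(u,x)$, and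
  likewise \<open>mop\<close> for modules; \<open>charge\<close> is the central charge and \<open>antiaut\<close> is $\Theta$.\<close>

record 'v voa = "'v ispace" +
  vop :: "'v \<Rightarrow> int \<Rightarrow> 'v \<Rightarrow> 'v"
  vac :: 'v
  conf :: 'v
  charge :: complex
  antiaut :: "'v \<Rightarrow> 'v"

record ('v, 'w) vmod = "'w ispace" +
  mop :: "'v \<Rightarrow> int \<Rightarrow> 'w \<Rightarrow> 'w"

definition vL :: "('v, 'z) voa_scheme \<Rightarrow> int \<Rightarrow> 'v \<Rightarrow> 'v" where
  "vL V n = vop V (conf V) (n + 1)"

definition mL :: "('v, 'z) voa_scheme \<Rightarrow> ('v, 'w, 'y) vmod_scheme \<Rightarrow> int \<Rightarrow> 'w \<Rightarrow> 'w" where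
  "mL V W n = mop W (conf V) (n + 1)"

text \<open>Modes are indexed by \<open>'s\<close>: integers for (module) vertex operators, reals for intertwining
  operators. All sums in the Jacobi identity have finite support by lower truncation.\<close>

definition lower_truncated :: "('i \<Rightarrow> 's::linorder \<Rightarrow> 'j \<Rightarrow> 'k::zero) \<Rightarrow> bool" where
  "lower_truncated A \<longleftrightarrow> (\<forall>w w'. \<exists>N. \<forall>s\<ge>N. A w s w' = 0)"

definition bilinear_modes ::
    "(complex \<Rightarrow> 'i::ab_group_add \<Rightarrow> 'i) \<Rightarrow> (complex \<Rightarrow> 'j::ab_group_add \<Rightarrow> 'j) \<Rightarrow>
     (complex \<Rightarrow> 'k::ab_group_add \<Rightarrow> 'k) \<Rightarrow> ('i \<Rightarrow> 's \<Rightarrow> 'j \<Rightarrow> 'k) \<Rightarrow> bool" where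
  "bilinear_modes si sj sk A \<longleftrightarrow>
     (\<forall>s w'. Vector_Spaces.linear si sk (\<lambda>w. A w s w')) \<and>
     (\<forall>w s. Vector_Spaces.linear sj sk (A w s))"

definition jacobi_identity ::
    "(complex \<Rightarrow> 'k::ab_group_add \<Rightarrow> 'k) \<Rightarrow> ('v \<Rightarrow> int \<Rightarrow> 'i \<Rightarrow> 'i) \<Rightarrow> ('v \<Rightarrow> int \<Rightarrow> 'j \<Rightarrow> 'j) \<Rightarrow>
     ('v \<Rightarrow> int \<Rightarrow> 'k \<Rightarrow> 'k) \<Rightarrow> ('i \<Rightarrow> 's::ring_1 \<Rightarrow> 'j \<Rightarrow> 'k) \<Rightarrow> bool" where
  "jacobi_identity sk Yi Yj Yk A \<longleftrightarrow>
     (\<forall>u w w' m n s.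
        Sum_any (\<lambda>l. sk (of_int m gchoose l) (A (Yi u (n + int l) w) (of_int m + s - of_nat l) w')) =
        Sum_any (\<lambda>l. sk ((-1) ^ l * (of_int n gchoose l))
                        (Yk u (m + n - int l) (A w (s + of_nat l) w'))) -
        Sum_any (\<lambda>l. sk ((-1) powi (n + int l) * (of_int n gchoose l))
                        (A w (of_int n + s - of_nat l) (Yj u (m + int l) w'))))"

definition virasoro_relations ::
    "(complex \<Rightarrow> 'w::ab_group_add \<Rightarrow> 'w) \<Rightarrow> complex \<Rightarrow> (int \<Rightarrow> 'w \<Rightarrow> 'w) \<Rightarrow> bool" where
  "virasoro_relations sm c L \<longleftrightarrow>
     (\<forall>m n w. L m (L n w) - L n (L m w) =
        sm (of_int (m - n)) (L (m + n) w) +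
        (if m + n = 0 then sm (c / 12 * of_int (m ^ 3 - m)) w else 0))"

definition VOA :: "('v::ab_group_add, 'z) voa_scheme \<Rightarrow> bool" where
  "VOA V \<longleftrightarrow>
     vector_space (smult V) \<and>
     bilinear_modes (smult V) (smult V) (smult V) (vop V) \<and>
     lower_truncated (vop V) \<and>
     (\<forall>n v. vop V (vac V) n v = (if n = -1 then v else 0)) \<and>
     (\<forall>v. vop V v (-1) (vac V) = v \<and> (\<forall>n\<ge>0. vop V v n (vac V) = 0)) \<and>
     jacobi_identity (smult V) (vop V) (vop V) (vop V) (vop V) \<and>
     virasoro_relations (smult V) (charge V) (vL V) \<and>
     internal_direct_sum (smult V) (\<lambda>n::int. eigenspace (smult V) (vL V 0) (of_int n)) \<and>
     (\<forall>n::int. fin_dim (smult V) (eigenspace (smult V) (vL V 0) (of_int n))) \<and>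
     (\<exists>N::int. \<forall>n<N. eigenspace (smult V) (vL V 0) (of_int n) = {0}) \<and>
     (\<forall>v n w. vop V (vL V (-1) v) n w = smult V (- of_int n) (vop V v (n - 1) w))"

definition vgrade :: "('v, 'z) voa_scheme \<Rightarrow> int \<Rightarrow> 'v set" where
  "vgrade V n = eigenspace (smult V) (vL V 0) (of_int n)"

definition CFT_type :: "('v::ab_group_add, 'z) voa_scheme \<Rightarrow> bool" where
  "CFT_type V \<longleftrightarrow> (\<forall>n<0. vgrade V n = {0}) \<and> vgrade V 0 = module.span (smult V) {vac V}"

text \<open>Modules are ordinary ones: $L_0$ is diagonalizable with finite-dimensional eigenspaces and
  its eigenvalues are bounded below in each coset of the integers.\<close>

definition VOA_module ::
    "('v::ab_group_add, 'z) voa_scheme \<Rightarrow> ('v, 'w::ab_group_add, 'y) vmod_scheme \<Rightarrow> bool" where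
  "VOA_module V W \<longleftrightarrow>
     vector_space (smult W) \<and>
     bilinear_modes (smult V) (smult W) (smult W) (mop W) \<and>
     lower_truncated (mop W) \<and>
     (\<forall>n w. mop W (vac V) n w = (if n = -1 then w else 0)) \<and>
     jacobi_identity (smult W) (vop V) (mop W) (mop W) (mop W) \<and>
     virasoro_relations (smult W) (charge V) (mL V W) \<and>
     internal_direct_sum (smult W) (eigenspace (smult W) (mL V W 0)) \<and>
     (\<forall>a. fin_dim (smult W) (eigenspace (smult W) (mL V W 0) a)) \<and>
     (\<forall>a. \<exists>N::int. \<forall>n<N. eigenspace (smult W) (mL V W 0) (a + of_int n) = {0}) \<and>
     (\<forall>v n w. mop W (vL V (-1) v) n w = smult W (- of_int n) (mop W v (n - 1) w))"

text \<open>The identity $\langle Y_i(v,x)w_1|w_2\rangle =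
  \langle w_1|Y_i(e^{xL_1}(-x^{-2})^{L_0}\Theta v,x^{-1})w_2\rangle$ for $v\in V(d)$, after
  comparing coefficients of $x^{-m-1}$ (the formal variable is real, and $\Theta v\in V(d)$).
  As $V$ is spanned by homogeneous vectors this is the full identity.\<close>

definition invariant_under ::
    "('v::ab_group_add, 'z) voa_scheme \<Rightarrow> ('w \<Rightarrow> 'w \<Rightarrow> complex) \<Rightarrow> ('v \<Rightarrow> int \<Rightarrow> 'w \<Rightarrow> 'w) \<Rightarrow> bool" where
  "invariant_under V f Yi \<longleftrightarrow>
     (\<forall>d. \<forall>v\<in>vgrade V d. \<forall>m w1 w2.
        f (Yi v m w1) w2 =
        (-1) powi d *
        Sum_any (\<lambda>k. f w1 (Yi (smult V (1 / fact k) ((vL V 1 ^^ k) (antiaut V v)))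
                             (2 * d - int k - m - 2) w2)))"

definition antilinear_automorphism :: "('v::ab_group_add, 'z) voa_scheme \<Rightarrow> ('v \<Rightarrow> 'v) \<Rightarrow> bool" where
  "antilinear_automorphism V \<theta> \<longleftrightarrow>
     bij \<theta> \<and>
     (\<forall>u v. \<theta> (u + v) = \<theta> u + \<theta> v) \<and>
     (\<forall>a v. \<theta> (smult V a v) = smult V (cnj a) (\<theta> v)) \<and>
     \<theta> (vac V) = vac V \<and> \<theta> (conf V) = conf V \<and>
     (\<forall>u n v. \<theta> (vop V u n v) = vop V (\<theta> u) n (\<theta> v))"

definition unitary_VOA :: "('v::ab_group_add, 'z) voa_scheme \<Rightarrow> bool" where
  "unitary_VOA V \<longleftrightarrow>
     VOA V \<and>
     antilinear_automorphism V (antiaut V) \<and>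
     inner_product_on (smult V) UNIV (iprod V) \<and>
     iprod V (vac V) (vac V) = 1 \<and>
     invariant_under V (iprod V) (vop V)"

definition unitary_module ::
    "('v::ab_group_add, 'z) voa_scheme \<Rightarrow> ('v, 'w::ab_group_add, 'y) vmod_scheme \<Rightarrow> bool" where
  "unitary_module V W \<longleftrightarrow>
     VOA_module V W \<and>
     inner_product_on (smult W) UNIV (iprod W) \<and>
     invariant_under V (iprod W) (mop W)"

definition homogeneous ::
    "('v, 'z) voa_scheme \<Rightarrow> ('v, 'w::zero, 'y) vmod_scheme \<Rightarrow> 'w \<Rightarrow> bool" where
  "homogeneous V W w \<longleftrightarrow> w \<noteq> 0 \<and> (\<exists>a. w \<in> eigenspace (smult W) (mL V W 0) a)"

text \<open>\<open>A w s\<close> is the mode $\mathcal Y(w,s)$, the coefficient of $x^{-s-1}$; the operator has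
  type ${k \choose i\;j}$.\<close>

definition intertwining_operator ::
    "('v::ab_group_add, 'z) voa_scheme \<Rightarrow> ('v, 'i::ab_group_add, 'x) vmod_scheme \<Rightarrow>
     ('v, 'j::ab_group_add, 'y) vmod_scheme \<Rightarrow> ('v, 'k::ab_group_add, 'u) vmod_scheme \<Rightarrow>
     ('i \<Rightarrow> real \<Rightarrow> 'j \<Rightarrow> 'k) \<Rightarrow> bool" where
  "intertwining_operator V Wi Wj Wk A \<longleftrightarrow>
     bilinear_modes (smult Wi) (smult Wj) (smult Wk) A \<and>
     lower_truncated A \<and>
     jacobi_identity (smult Wk) (mop Wi) (mop Wj) (mop Wk) A \<and>
     (\<forall>w s w'. A (mL V Wi (-1) w) s w' = smult Wk (- of_real s) (A w (s - 1) w'))"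

text \<open>Functional calculus on the eigenspaces of $L_0$; on unitary modules all eigenvalues
  are real and non-negative.\<close>

definition one_plus_L0_powr ::
    "('v, 'z) voa_scheme \<Rightarrow> ('v, 'w::ab_group_add, 'y) vmod_scheme \<Rightarrow> real \<Rightarrow> 'w \<Rightarrow> 'w" where
  "one_plus_L0_powr V W r w =
     Sum_any (\<lambda>a. smult W ((1 + a) powr of_real r)
                         (component (eigenspace (smult W) (mL V W 0)) w a))"

text \<open>Here \<open>B\<close> is the family of modes $s\mapsto\mathcal Y(w,s)$ for a fixed vector $w$.\<close>

definition energy_bounds ::
    "('v, 'z) voa_scheme \<Rightarrow> ('v, 'j::ab_group_add, 'y) vmod_scheme \<Rightarrow> ('v, 'k, 'u) vmod_scheme \<Rightarrow>
     real \<Rightarrow> (real \<Rightarrow> 'j \<Rightarrow> 'k) \<Rightarrow> bool" where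
  "energy_bounds V Wj Wk r B \<longleftrightarrow>
     (\<exists>M\<ge>0. \<exists>t\<ge>0. \<forall>s w'.
        vnorm Wk (B s w') \<le> M * (1 + \<bar>s\<bar>) powr t * vnorm Wj (one_plus_L0_powr V Wj r w'))"


section \<open>Lie subalgebras of the weight-one space\<close>

definition bracket :: "('v, 'z) voa_scheme \<Rightarrow> 'v \<Rightarrow> 'v \<Rightarrow> 'v" where
  "bracket V u v = vop V u 0 v"

definition star :: "('v::uminus, 'z) voa_scheme \<Rightarrow> 'v \<Rightarrow> 'v" where
  "star V v = - antiaut V v"

definition lie_subalgebra :: "('v::ab_group_add, 'z) voa_scheme \<Rightarrow> 'v set \<Rightarrow> bool" where
  "lie_subalgebra V g \<longleftrightarrow>
     module.subspace (smult V) g \<and> g \<subseteq> vgrade V 1 \<and> (\<forall>u\<in>g. \<forall>v\<in>g. bracket V u v \<in> g)"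

definition simple_lie_subalgebra :: "('v::ab_group_add, 'z) voa_scheme \<Rightarrow> 'v set \<Rightarrow> bool" where
  "simple_lie_subalgebra V g \<longleftrightarrow>
     lie_subalgebra V g \<and>
     (\<exists>u\<in>g. \<exists>v\<in>g. bracket V u v \<noteq> 0) \<and>
     (\<forall>I. module.subspace (smult V) I \<and> I \<subseteq> g \<and> (\<forall>u\<in>g. \<forall>v\<in>I. bracket V u v \<in> I) \<longrightarrow>
          I = {0} \<or> I = g)"

definition unitary_simple_lie_subalgebra :: "('v::ab_group_add, 'z) voa_scheme \<Rightarrow> 'v set \<Rightarrow> bool" where
  "unitary_simple_lie_subalgebra V g \<longleftrightarrow> simple_lie_subalgebra V g \<and> star V ` g = g"

primrec lower_central :: "('v::ab_group_add, 'z) voa_scheme \<Rightarrow> 'v set \<Rightarrow> nat \<Rightarrow> 'v set" where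
  "lower_central V h 0 = h"
| "lower_central V h (Suc n) =
     module.span (smult V) {bracket V u v | u v. u \<in> h \<and> v \<in> lower_central V h n}"

text \<open>A Cartan subalgebra is a nilpotent subalgebra that equals its own normalizer.\<close>

definition cartan_subalgebra :: "('v::ab_group_add, 'z) voa_scheme \<Rightarrow> 'v set \<Rightarrow> 'v set \<Rightarrow> bool" where
  "cartan_subalgebra V g h \<longleftrightarrow>
     lie_subalgebra V h \<and> h \<subseteq> g \<and>
     (\<exists>n. lower_central V h n = {0}) \<and>
     {u\<in>g. \<forall>v\<in>h. bracket V u v \<in> h} = h"

text \<open>A linear functional on \<open>h\<close> is represented by its extension by zero, so that equality of
  functionals is equality of functions.\<close>

definition functional_on :: "('v::ab_group_add, 'z) voa_scheme \<Rightarrow> 'v set \<Rightarrow> ('v \<Rightarrow> complex) \<Rightarrow> bool" where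
  "functional_on V h \<alpha> \<longleftrightarrow> linear_on (smult V) (*) h \<alpha> \<and> (\<forall>x. x \<notin> h \<longrightarrow> \<alpha> x = 0)"

definition root_space :: "('v, 'z) voa_scheme \<Rightarrow> 'v set \<Rightarrow> 'v set \<Rightarrow> ('v \<Rightarrow> complex) \<Rightarrow> 'v set" where
  "root_space V g h \<alpha> = {x\<in>g. \<forall>H\<in>h. bracket V H x = smult V (\<alpha> H) x}"

definition roots :: "('v::ab_group_add, 'z) voa_scheme \<Rightarrow> 'v set \<Rightarrow> 'v set \<Rightarrow> ('v \<Rightarrow> complex) set" where
  "roots V g h =
     {\<alpha>. functional_on V h \<alpha> \<and> (\<exists>H\<in>h. \<alpha> H \<noteq> 0) \<and> root_space V g h \<alpha> \<noteq> {0}}"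

definition positive_roots ::
    "('v::ab_group_add, 'z) voa_scheme \<Rightarrow> 'v set \<Rightarrow> 'v set \<Rightarrow> ('v \<Rightarrow> complex) set \<Rightarrow> bool" where
  "positive_roots V g h P \<longleftrightarrow>
     P \<subseteq> roots V g h \<and>
     (\<forall>\<alpha>\<in>roots V g h. (\<alpha> \<in> P) \<noteq> ((\<lambda>x. - \<alpha> x) \<in> P)) \<and>
     (\<forall>\<alpha>\<in>P. \<forall>\<beta>\<in>P. (\<lambda>x. \<alpha> x + \<beta> x) \<in> roots V g h \<longrightarrow> (\<lambda>x. \<alpha> x + \<beta> x) \<in> P)"

definition invariant_inner_product ::
    "('v::ab_group_add, 'z) voa_scheme \<Rightarrow> 'v set \<Rightarrow> ('v \<Rightarrow> 'v \<Rightarrow> complex) \<Rightarrow> bool" where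
  "invariant_inner_product V g f \<longleftrightarrow>
     inner_product_on (smult V) g f \<and>
     (\<forall>u\<in>g. \<forall>v\<in>g. \<forall>w\<in>g. f (bracket V u v) w = f v (bracket V (star V u) w))"

text \<open>The length of \<open>\<alpha>\<close> for the inner product on the dual of \<open>h\<close> induced by \<open>f\<close>: the
  length of the vector that represents \<open>\<alpha>\<close> by the Riesz isomorphism.\<close>

definition root_length :: "'v set \<Rightarrow> ('v \<Rightarrow> 'v \<Rightarrow> complex) \<Rightarrow> ('v \<Rightarrow> complex) \<Rightarrow> real" where
  "root_length h f \<alpha> =
     (let T = (THE T. T \<in> h \<and> (\<forall>H\<in>h. \<alpha> H = f H T)) in sqrt (Re (f T T)))"

definition normalized_inner_product ::
    "('v::ab_group_add, 'z) voa_scheme \<Rightarrow> 'v set \<Rightarrow> 'v set \<Rightarrow> ('v \<Rightarrow> 'v \<Rightarrow> complex) \<Rightarrow> bool" where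
  "normalized_inner_product V g h f \<longleftrightarrow>
     invariant_inner_product V g f \<and>
     (\<forall>\<alpha>\<in>roots V g h. root_length h f \<alpha> \<le> sqrt 2) \<and>
     (\<exists>\<alpha>\<in>roots V g h. root_length h f \<alpha> = sqrt 2)"

text \<open>The level is only declared to be a real number; that it is a non-negative integer is a
  consequence of unitarity.\<close>

definition is_level ::
    "('v, 'z) voa_scheme \<Rightarrow> 'v set \<Rightarrow> ('v \<Rightarrow> 'v \<Rightarrow> complex) \<Rightarrow> real \<Rightarrow> bool" where
  "is_level V g f l \<longleftrightarrow> (\<forall>u\<in>g. \<forall>v\<in>g. iprod V u v = of_real l * f u v)"


section \<open>Modules of the affine algebra\<close>

text \<open>A module of the affine algebra on which $K$ acts as $l$ is given by the operators
  \<open>X x n\<close> by which $x\otimes t^n$ acts; the Lie algebra \<open>g\<close> acts by \<open>X x 0\<close>.\<close>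

definition affine_rep ::
    "('v::ab_group_add, 'z) voa_scheme \<Rightarrow> 'v set \<Rightarrow> ('v \<Rightarrow> 'v \<Rightarrow> complex) \<Rightarrow> real \<Rightarrow>
     (complex \<Rightarrow> 'w::ab_group_add \<Rightarrow> 'w) \<Rightarrow> ('v \<Rightarrow> int \<Rightarrow> 'w \<Rightarrow> 'w) \<Rightarrow> bool" where
  "affine_rep V g f l sm X \<longleftrightarrow>
     vector_space sm \<and>
     (\<forall>x\<in>g. \<forall>n. Vector_Spaces.linear sm sm (X x n)) \<and>
     (\<forall>n w. linear_on (smult V) sm g (\<lambda>x. X x n w)) \<and>
     (\<forall>x\<in>g. \<forall>y\<in>g. \<forall>m n w.
        X x m (X y n w) - X y n (X x m w) =
        X (bracket V x y) (m + n) w +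
        (if m = - n then sm (of_int m * f x (star V y) * of_real l) w else 0))"

definition irreducible_under ::
    "(complex \<Rightarrow> 'w::ab_group_add \<Rightarrow> 'w) \<Rightarrow> ('w \<Rightarrow> 'w) set \<Rightarrow> 'w set \<Rightarrow> bool" where
  "irreducible_under sm F S \<longleftrightarrow>
     module.subspace sm S \<and> S \<noteq> {0} \<and> (\<forall>T\<in>F. T ` S \<subseteq> S) \<and>
     (\<forall>U. module.subspace sm U \<and> U \<subseteq> S \<and> (\<forall>T\<in>F. T ` U \<subseteq> U) \<longrightarrow> U = {0} \<or> U = S)"

definition g_highest_weight_vector ::
    "('v, 'z) voa_scheme \<Rightarrow> 'v set \<Rightarrow> 'v set \<Rightarrow> ('v \<Rightarrow> complex) set \<Rightarrow>
     (complex \<Rightarrow> 'w::zero \<Rightarrow> 'w) \<Rightarrow> ('v \<Rightarrow> 'w \<Rightarrow> 'w) \<Rightarrow> ('v \<Rightarrow> complex) \<Rightarrow> 'w \<Rightarrow> bool" where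
  "g_highest_weight_vector V g h P sm \<rho> lam w \<longleftrightarrow>
     w \<noteq> 0 \<and>
     (\<forall>\<alpha>\<in>P. \<forall>x\<in>root_space V g h \<alpha>. \<rho> x w = 0) \<and>
     (\<forall>H\<in>h. \<rho> H w = sm (lam H) w)"

definition highest_weight_vector ::
    "('v, 'z) voa_scheme \<Rightarrow> 'v set \<Rightarrow> 'v set \<Rightarrow> ('v \<Rightarrow> complex) set \<Rightarrow>
     (complex \<Rightarrow> 'w::zero \<Rightarrow> 'w) \<Rightarrow> ('v \<Rightarrow> int \<Rightarrow> 'w \<Rightarrow> 'w) \<Rightarrow> ('v \<Rightarrow> complex) \<Rightarrow> 'w \<Rightarrow> bool" where
  "highest_weight_vector V g h P sm X lam w \<longleftrightarrow>
     g_highest_weight_vector V g h P sm (\<lambda>x. X x 0) lam w \<and>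
     (\<forall>x\<in>g. \<forall>n>0. X x n w = 0)"

text \<open>The \<open>g\<close>-submodule generated by \<open>w\<close>.\<close>

definition g_submodule ::
    "'v set \<Rightarrow> (complex \<Rightarrow> 'w::ab_group_add \<Rightarrow> 'w) \<Rightarrow> ('v \<Rightarrow> 'w \<Rightarrow> 'w) \<Rightarrow> 'w \<Rightarrow> 'w set" where
  "g_submodule g sm \<rho> w =
     \<Inter>{S. module.subspace sm S \<and> w \<in> S \<and> (\<forall>x\<in>g. \<forall>u\<in>S. \<rho> x u \<in> S)}"

text \<open>Positive energy: a grading by energies $n\ge0$, lowered by $m$ by the operators $x\otimes t^m$,
  with non-zero lowest energy subspace \<open>E 0\<close>.\<close>

definition positive_energy_grading ::
    "'v set \<Rightarrow> (complex \<Rightarrow> 'w::ab_group_add \<Rightarrow> 'w) \<Rightarrow> ('v \<Rightarrow> int \<Rightarrow> 'w \<Rightarrow> 'w) \<Rightarrow> (nat \<Rightarrow> 'w set) \<Rightarrow> bool" where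
  "positive_energy_grading g sm X E \<longleftrightarrow>
     internal_direct_sum sm E \<and> E 0 \<noteq> {0} \<and>
     (\<forall>x\<in>g. \<forall>m n. \<forall>w\<in>E n.
        if m \<le> int n then X x m w \<in> E (nat (int n - m)) else X x m w = 0)"

text \<open>The operators \<open>X\<close> on \<open>W\<close>, graded by \<open>E\<close>, form the irreducible unitary positive energy
  module $L_{\mathfrak g}(\lambda,l)$; its lowest energy subspace \<open>E 0\<close> is the irreducible
  unitary \<open>g\<close>-module $L_{\mathfrak g}(\lambda)$.\<close>

definition is_L ::
    "('v::ab_group_add, 'z) voa_scheme \<Rightarrow> 'v set \<Rightarrow> 'v set \<Rightarrow> ('v \<Rightarrow> complex) set \<Rightarrow>
     ('v \<Rightarrow> 'v \<Rightarrow> complex) \<Rightarrow> real \<Rightarrow> ('v \<Rightarrow> complex) \<Rightarrow>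
     ('w::ab_group_add, 'y) ispace_scheme \<Rightarrow> ('v \<Rightarrow> int \<Rightarrow> 'w \<Rightarrow> 'w) \<Rightarrow> (nat \<Rightarrow> 'w set) \<Rightarrow> bool" where
  "is_L V g h P f l lam W X E \<longleftrightarrow>
     affine_rep V g f l (smult W) X \<and>
     inner_product_on (smult W) UNIV (iprod W) \<and>
     (\<forall>x\<in>g. \<forall>n u v. iprod W (X x n u) v = iprod W u (X (star V x) (- n) v)) \<and>
     irreducible_under (smult W) {X x n | x n. x \<in> g} UNIV \<and>
     positive_energy_grading g (smult W) X E \<and>
     irreducible_under (smult W) {X x 0 | x. x \<in> g} (E 0) \<and>
     (\<exists>w\<in>E 0. g_highest_weight_vector V g h P (smult W) (\<lambda>x. X x 0) lam w)"


section \<open>Affine vertex operator algebras and their modules\<close>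

definition orthonormal_basis ::
    "('v::ab_group_add, 'z) voa_scheme \<Rightarrow> 'v set \<Rightarrow> ('v \<Rightarrow> 'v \<Rightarrow> complex) \<Rightarrow> 'v set \<Rightarrow> bool" where
  "orthonormal_basis V g f B \<longleftrightarrow>
     finite B \<and> B \<subseteq> g \<and> g \<subseteq> module.span (smult V) B \<and>
     (\<forall>b\<in>B. \<forall>b'\<in>B. f b b' = (if b = b' then 1 else 0))"

text \<open>The Sugawara vector $\frac1{2(l+h^\vee)}\sum_b b(-1)b^*(-1)\Omega$. With respect to the
  bilinear form $(x|y^*)$ the dual basis of an orthonormal basis $(b)$ is $(b^*)$, and the dual
  Coxeter number $h^\vee$ is half the eigenvalue of the Casimir element in the adjoint
  representation. The map \<open>\<iota>\<close> sends $x$ to $x(-1)\Omega$.\<close>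

definition is_sugawara ::
    "('v::ab_group_add, 'z) voa_scheme \<Rightarrow> 'v set \<Rightarrow> ('v \<Rightarrow> 'v \<Rightarrow> complex) \<Rightarrow> real \<Rightarrow>
     ('u::ab_group_add, 'y) voa_scheme \<Rightarrow> ('v \<Rightarrow> 'u) \<Rightarrow> 'u \<Rightarrow> bool" where
  "is_sugawara V g f l U \<iota> w \<longleftrightarrow>
     (\<exists>B (dual_coxeter::real).
        orthonormal_basis V g f B \<and>
        (\<forall>x\<in>g. (\<Sum>b\<in>B. bracket V b (bracket V (star V b) x)) =
                 smult V (of_real (2 * dual_coxeter)) x) \<and>
        w = smult U (of_real (1 / (2 * (l + dual_coxeter))))
                    (\<Sum>b\<in>B. vop U (\<iota> b) (-1) (\<iota> (star V b))))"

text \<open>\<open>U\<close> is $V^l_{\mathfrak g}$, with \<open>\<iota> x\<close> the vector $x(-1)\Omega$: the unitary VOA structure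
  on $L_{\mathfrak g}(0,l)$ with $Y(x(-1)\Omega,n)=x(n)$ and the Sugawara conformal vector.\<close>

definition affine_VOA ::
    "('v::ab_group_add, 'z) voa_scheme \<Rightarrow> 'v set \<Rightarrow> 'v set \<Rightarrow> ('v \<Rightarrow> complex) set \<Rightarrow>
     ('v \<Rightarrow> 'v \<Rightarrow> complex) \<Rightarrow> real \<Rightarrow> ('u::ab_group_add, 'y) voa_scheme \<Rightarrow> ('v \<Rightarrow> 'u) \<Rightarrow> bool" where
  "affine_VOA V g h P f l U \<iota> \<longleftrightarrow>
     unitary_VOA U \<and> CFT_type U \<and>
     (\<exists>E. is_L V g h P f l (\<lambda>_. 0) U (\<lambda>x. vop U (\<iota> x)) E \<and>
          E 0 = module.span (smult U) {vac U}) \<and>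
     is_sugawara V g f l U \<iota> (conf U)"

text \<open>Modules of the affine VOA, together with the grading by energies.\<close>

record ('u, 'w) amod = "('u, 'w) vmod" +
  energy :: "nat \<Rightarrow> 'w set"

text \<open>\<open>M\<close> is $L_{\mathfrak g}(\lambda,l)$ as a unitary $V^l_{\mathfrak g}$-module, with
  $Y_\lambda(x(-1)\Omega,n)=x(n)$.\<close>

definition affine_module ::
    "('v::ab_group_add, 'z) voa_scheme \<Rightarrow> 'v set \<Rightarrow> 'v set \<Rightarrow> ('v \<Rightarrow> complex) set \<Rightarrow>
     ('v \<Rightarrow> 'v \<Rightarrow> complex) \<Rightarrow> real \<Rightarrow> ('u::ab_group_add, 'y) voa_scheme \<Rightarrow> ('v \<Rightarrow> 'u) \<Rightarrow>
     ('v \<Rightarrow> complex) \<Rightarrow> ('u, 'w::ab_group_add, 'x) amod_scheme \<Rightarrow> bool" where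
  "affine_module V g h P f l U \<iota> lam M \<longleftrightarrow>
     unitary_module U M \<and>
     is_L V g h P f l lam M (\<lambda>x. mop M (\<iota> x)) (energy M)"

definition Lg :: "('u, 'w, 'x) amod_scheme \<Rightarrow> 'w set" where
  "Lg M = energy M 0"

definition Delta :: "('u, 'y) voa_scheme \<Rightarrow> ('u, 'w::zero, 'x) vmod_scheme \<Rightarrow> real" where
  "Delta U M = (LEAST a::real. eigenspace (smult M) (mL U M 0) (of_real a) \<noteq> {0})"

text \<open>An isometric \<open>g\<close>-module homomorphism from $L_{\mathfrak g}(\lambda)$ to the
  \<open>V\<close>-module \<open>W\<close>.\<close>

definition isometric_g_hom ::
    "'v set \<Rightarrow> ('v \<Rightarrow> 'u) \<Rightarrow> ('u, 'a::ab_group_add, 'x) amod_scheme \<Rightarrow>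
     ('v, 'w::ab_group_add, 'y) vmod_scheme \<Rightarrow> ('a \<Rightarrow> 'w) \<Rightarrow> bool" where
  "isometric_g_hom g \<iota> M W \<phi> \<longleftrightarrow>
     linear_on (smult M) (smult W) (Lg M) \<phi> \<and>
     (\<forall>x\<in>g. \<forall>u\<in>Lg M. \<phi> (mop M (\<iota> x) 0 u) = mop W x 0 (\<phi> u)) \<and>
     (\<forall>u\<in>Lg M. \<forall>v\<in>Lg M. iprod W (\<phi> u) (\<phi> v) = iprod M u v)"

definition formal_adjoint ::
    "('u, 'a, 'x) amod_scheme \<Rightarrow> ('w, 'y) ispace_scheme \<Rightarrow> ('a \<Rightarrow> 'w) \<Rightarrow> ('w \<Rightarrow> 'a) \<Rightarrow> bool" where
  "formal_adjoint M W \<phi> \<phi>d \<longleftrightarrow>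
     (\<forall>w. \<phi>d w \<in> Lg M) \<and> (\<forall>u\<in>Lg M. \<forall>w. iprod W (\<phi> u) w = iprod M u (\<phi>d w))"

text \<open>$\mathrm{Hom}_{\mathfrak g}(L_{\mathfrak g}(\lambda)\otimes L_{\mathfrak g}(\mu),
  L_{\mathfrak g}(\nu))$, with linear maps on the tensor product given as bilinear maps.\<close>

definition Hom_g ::
    "'v set \<Rightarrow> ('v \<Rightarrow> 'u) \<Rightarrow> ('u, 'a::ab_group_add, 'x) amod_scheme \<Rightarrow>
     ('u, 'b::ab_group_add, 'y) amod_scheme \<Rightarrow> ('u, 'c::ab_group_add, 'z) amod_scheme \<Rightarrow>
     ('a \<Rightarrow> 'b \<Rightarrow> 'c) set" where
  "Hom_g g \<iota> A B C =
     {T. (\<forall>u\<in>Lg A. \<forall>v\<in>Lg B. T u v \<in> Lg C) \<and>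
         (\<forall>v\<in>Lg B. linear_on (smult A) (smult C) (Lg A) (\<lambda>u. T u v)) \<and>
         (\<forall>u\<in>Lg A. linear_on (smult B) (smult C) (Lg B) (T u)) \<and>
         (\<forall>x\<in>g. \<forall>u\<in>Lg A. \<forall>v\<in>Lg B.
            T (mop A (\<iota> x) 0 u) v + T u (mop B (\<iota> x) 0 v) = mop C (\<iota> x) 0 (T u v))}"

definition Psi ::
    "('u, 'y) voa_scheme \<Rightarrow> ('u, 'a::zero, 'x) vmod_scheme \<Rightarrow> ('u, 'b::zero, 's) vmod_scheme \<Rightarrow>
     ('u, 'c::zero, 't) vmod_scheme \<Rightarrow> ('a \<Rightarrow> real \<Rightarrow> 'b \<Rightarrow> 'c) \<Rightarrow> 'a \<Rightarrow> 'b \<Rightarrow> 'c" where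
  "Psi U A B C \<Y> u v = \<Y> u (Delta U A + Delta U B - Delta U C - 1) v"

end

theory Submission
  imports Defs
begin

text \<open>Let \<open>\<Phi>\<close> denote the isometric extensions of the three \<open>\<phi>\<close>'s to the affine modules; they exist
  because inner products of vectors generated from a lowest energy space are determined by the
  commutation relations. Then \<open>\<Y>(u, t) = \<Phi>\<^sup>\<dagger> \<YY>(\<Phi> u, t + \<kappa>) \<Phi>\<close> satisfies the Jacobi identity, since the
  affine VOA itself embeds into \<open>V\<close> and all \<open>\<Phi>\<close> and \<open>\<Phi>\<^sup>\<dagger>\<close> intertwine its action. On the image of each
  \<open>\<Phi>\<close> the operator \<open>L\<^sub>0\<close> of \<open>V\<close> is that of the affine VOA plus a constant. The derivative property of
  \<open>\<Y>\<close> is equivalent to a relation between the weights of \<open>\<Y>(u, t) v\<close>, \<open>u\<close> and \<open>v\<close>, which holds exactly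
  when \<open>\<kappa>\<close> is the corresponding combination of these constants; as the given map is non-zero, this
  is also the \<open>\<kappa>\<close> for which the lowest mode of \<open>\<Y>\<close> is the given one. Energy bounds pass to \<open>\<Y>\<close> because
  \<open>\<Phi>\<^sup>\<dagger>\<close> is a contraction.\<close>

section \<open>Inner product spaces\<close>

text \<open>The obstacle is that the conformal vector of the affine VOA need not be that of
  \<open>V\<close>: the two may differ by the conformal vector of the commutant. Whatever is
  expressed through currents passes along \<Phi> and its adjoint; L_0 and L_{-1} do not. The two
  operators L_0 have the same commutators with the currents, so by irreducibility their difference
  on the image of \<Phi> is one scalar, fixed by its value on the lowest energy space. L_{-1} of
  \<open>V\<close> is never compared with that of the affine VOA: in the commutator of a mode with
  L_0 of the affine VOA, the L_{-1} term is the only unknown once all weights are known. Positivity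
  of the inner products is used throughout. It makes the extension of \<phi> single valued,
  separates the eigenspaces of L_0, and keeps the spectrum of L_0 non-negative. The adjoint of
  \<Phi> exists without completing any space, because every vector has finitely many weight
  components and the weight spaces of the affine modules have finite dimension.\<close>

lemma Sum_any_hom:
  fixes F :: "'a::comm_monoid_add \<Rightarrow> 'b::comm_monoid_add"
  assumes "finite {i. f i \<noteq> 0}" and "F 0 = 0" and "\<And>x y. F (x + y) = F x + F y"
  shows "F (Sum_any f) = Sum_any (\<lambda>i. F (f i))"
proof -
  have sub: "{i. F (f i) \<noteq> 0} \<subseteq> {i. f i \<noteq> 0}"
    using assms(2) by auto
  have "F (sum f A) = (\<Sum>i\<in>A. F (f i))" if "finite A" for A
    using that by induction (simp_all add: assms)
  with assms(1) show ?thesis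
    unfolding Sum_any.expand_superset[OF assms(1) sub] Sum_any.expand_set[of f] by blast
qed

lemma Sum_any_at:
  assumes "\<And>i. i \<noteq> a \<Longrightarrow> f i = 0"
  shows "Sum_any f = f a"
  by (subst Sum_any.expand_superset[of "{a}"]) (use assms in auto)

lemma Sum_any_at2:
  assumes "\<And>i. i \<noteq> a \<Longrightarrow> i \<noteq> b \<Longrightarrow> f i = 0" and "a \<noteq> b"
  shows "Sum_any f = f a + f b"
  by (subst Sum_any.expand_superset[of "{a, b}"]) (use assms in auto)

locale ip_space = vector_space sm
  for sm :: "complex \<Rightarrow> 'w::ab_group_add \<Rightarrow> 'w" +
  fixes ip :: "'w \<Rightarrow> 'w \<Rightarrow> complex"
  assumes ip: "inner_product_on sm UNIV ip"
begin

lemma ip_add_left: "ip (u + v) w = ip u w + ip v w"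
  and ip_scale_left: "ip (sm a u) v = a * ip u v"
  and ip_commute: "ip v u = cnj (ip u v)"
  and ip_pos: "u \<noteq> 0 \<Longrightarrow> Re (ip u u) > 0"
proof -
  note * = ip[unfolded inner_product_on_def ball_UNIV]
  show "ip (u + v) w = ip u w + ip v w" using * by blast
  show "ip (sm a u) v = a * ip u v" by (rule *[THEN conjunct2, THEN conjunct1, rule_format])
  show "ip v u = cnj (ip u v)"
    by (rule *[THEN conjunct2, THEN conjunct2, THEN conjunct1, rule_format])
  show "Re (ip u u) > 0" if "u \<noteq> 0" using * that by blast
qed

lemma ip_add_right: "ip w (u + v) = ip w u + ip w v"
  by (metis complex_cnj_add ip_add_left ip_commute)

lemma ip_scale_right: "ip u (sm a v) = cnj a * ip u v"
  by (metis complex_cnj_mult ip_commute ip_scale_left)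

lemma ip_zero_left [simp]: "ip 0 v = 0"
  using ip_scale_left[of 0 0 v] by simp

lemma ip_zero_right [simp]: "ip v 0 = 0"
  using ip_scale_right[of v 0 0] by simp

lemma ip_minus_left: "ip (- u) v = - ip u v"
  using ip_scale_left[of "-1" u v] by simp

lemma ip_minus_right: "ip u (- v) = - ip u v"
  using ip_scale_right[of u "-1" v] by simp

lemma ip_diff_left: "ip (u - v) w = ip u w - ip v w"
  using ip_add_left[of u "- v" w] by (simp add: ip_minus_left)

lemma ip_diff_right: "ip w (u - v) = ip w u - ip w v"
  using ip_add_right[of w u "- v"] by (simp add: ip_minus_right)

lemma ip_sum_left: "ip (sum F A) v = (\<Sum>i\<in>A. ip (F i) v)"
  by (induction A rule: infinite_finite_induct) (simp_all add: ip_add_left)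

lemma ip_sum_right: "ip v (sum F A) = (\<Sum>i\<in>A. ip v (F i))"
  by (induction A rule: infinite_finite_induct) (simp_all add: ip_add_right)

lemma ip_self_eq_0 [simp]: "ip u u = 0 \<longleftrightarrow> u = 0"
  using ip_pos[of u] by (cases "u = 0") auto

lemma ip_self_Im [simp]: "Im (ip u u) = 0"
  using ip_commute[of u u] by (metis Reals_cnj_iff complex_is_Real_iff)

lemma ip_self_Re_nonneg [simp]: "Re (ip u u) \<ge> 0"
  using ip_pos[of u] by (cases "u = 0") auto

lemma ip_ext: "(\<And>u. ip u v = ip u w) \<Longrightarrow> v = w"
  using ip_diff_right[of "v - w" v w] ip_self_eq_0[of "v - w"] by simp

lemma ip_zero_on_span:
  assumes "\<And>u. u \<in> B \<Longrightarrow> ip u v = 0" and "w \<in> span B"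
  shows "ip w v = 0"
  using assms(2) by (induction rule: span_induct_alt)
    (simp_all add: ip_add_left ip_scale_left assms(1))

lemma subspace_eigenspace:
  assumes "Vector_Spaces.linear sm sm T"
  shows "subspace (eigenspace sm T a)"
proof -
  interpret T: Vector_Spaces.linear sm sm T by fact
  show ?thesis
    by (auto simp: subspace_def eigenspace_def T.add T.scale scale_right_distrib mult.commute)
qed

lemma eigenvalue_real:
  assumes "\<And>u v. ip (T u) v = ip u (T v)" and "v \<in> eigenspace sm T b" "v \<noteq> 0"
  shows "cnj b = b"
  using assms(1)[of v v] assms(2,3) by (simp add: eigenspace_def ip_scale_left ip_scale_right)

lemma eigenspaces_orthogonal:
  assumes sa: "\<And>u v. ip (T u) v = ip u (T v)"
    and "u \<in> eigenspace sm T a" "v \<in> eigenspace sm T b" "a \<noteq> b"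
  shows "ip u v = 0"
proof (cases "v = 0")
  case False
  then have "cnj b = b" using eigenvalue_real[OF sa assms(3)] by simp
  then have "a * ip u v = b * ip u v"
    using sa[of u v] assms(2,3) by (simp add: eigenspace_def ip_scale_left ip_scale_right)
  with assms(4) show ?thesis by simp
qed simp

text \<open>One Gram-Schmidt step per generator: the representing vector on the smaller span is
  corrected along the part of the new generator that is orthogonal to this span.\<close>

lemma riesz_span:
  assumes "finite B" and add: "\<And>u v. F (u + v) = F u + F v" and scale: "\<And>a u. F (sm a u) = a * F u"
  shows "\<exists>v\<in>span B. \<forall>u\<in>span B. F u = ip u v"
  using assms
proof (induction B arbitrary: F rule: finite_induct)
  case empty
  have "F 0 = 0" using empty(2)[of 0 0] by simp
  then show ?case by simp
next
  case (insert x B)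
  \<comment> \<open>Representing the functional \<open>\<lambda>y. ip y x\<close> on
    \<open>span B\<close> yields the orthogonal projection \<open>p\<close> of
    \<open>x\<close>.\<close>
  from insert.IH[of "\<lambda>y. ip y x"] obtain p where p: "p \<in> span B"
    and px: "\<And>y. y \<in> span B \<Longrightarrow> ip y x = ip y p"
    by (auto simp: ip_add_left ip_scale_left)
  define e where "e = x - p"
  have e_orth: "ip y e = 0" if "y \<in> span B" for y
    using px[OF that] by (simp add: e_def ip_diff_right)
  then have e_orth': "ip e y = 0" if "y \<in> span B" for y
    using that ip_commute[of e y] by simp
  from insert.IH[OF insert.prems] obtain v where v: "v \<in> span B"
    and Fv: "\<And>u. u \<in> span B \<Longrightarrow> F u = ip u v" by blast
  \<comment> \<open>The conjugate compensates for antilinearity in the second slot. If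
    \<open>e = 0\<close> then \<open>q = 0\<close>, which is consistent with
    \<open>F 0 = 0\<close>.\<close>
  define q where "q = sm (cnj (F e / ip e e)) e"
  have F0: "F 0 = 0" using insert.prems(1)[of 0 0] by simp
  have pB: "p \<in> span (insert x B)" and vB: "v \<in> span (insert x B)"
    using p v span_mono[of B "insert x B"] by auto
  have e_in: "e \<in> span (insert x B)"
    unfolding e_def by (intro span_diff pB span_base) simp
  have "F u = ip u (v + q)" if u: "u \<in> span (insert x B)" for u
  proof -
    from u obtain a where a: "u - sm a x \<in> span B" by (auto simp: span_insert)
    define y where "y = u - sm a x + sm a p"
    have y: "y \<in> span B" unfolding y_def by (intro span_add a span_scale p)
    have u_eq: "u = y + sm a e" by (simp add: y_def e_def algebra_simps)
    have "ip e q = F e"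
      using F0 by (cases "e = 0") (simp_all add: q_def ip_scale_right)
    moreover have "ip y q = 0" using e_orth[OF y] by (simp add: q_def ip_scale_right)
    ultimately show ?thesis
      by (simp add: u_eq ip_add_left ip_add_right ip_scale_left insert.prems Fv[OF y] e_orth'[OF v])
  qed
  moreover have "v + q \<in> span (insert x B)"
    unfolding q_def by (intro span_add vB span_scale e_in)
  ultimately show ?case by blast
qed

lemma riesz_fin_dim:
  assumes "fin_dim sm S" and S: "subspace S"
    and "\<And>u v. F (u + v) = F u + F v" and "\<And>a u. F (sm a u) = a * F u"
  shows "\<exists>v\<in>S. \<forall>u\<in>S. F u = ip u v"
proof -
  obtain C where C: "finite C" "S \<subseteq> span C" using assms(1) by (auto simp: fin_dim_def)
  obtain B where B: "B \<subseteq> S" "independent B" "S \<subseteq> span B"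
    using maximal_independent_subset[of S] by blast
  \<comment> \<open>\<open>C\<close> need not lie in \<open>S\<close>, but its size bounds every
    independent subset of \<open>S\<close>.\<close>
  have "finite B" using independent_span_bound[OF C(1) B(2)] B(1) C(2) by blast
  moreover have "span B = S" using B(1,3) S by (metis span_minimal subset_antisym)
  ultimately show ?thesis using riesz_span[of B F] assms(3,4) by metis
qed

end

section \<open>Unitary representations of affine algebras\<close>

text \<open>The pairing \<open>k x y\<close> is $l\,(x|y^*)$, and \<open>X x n\<close> is the action of $x \otimes t^n$.\<close>

locale affine_unitary = ip_space sm ip
  for sm :: "complex \<Rightarrow> 'w::ab_group_add \<Rightarrow> 'w" and ip :: "'w \<Rightarrow> 'w \<Rightarrow> complex" +
  fixes g :: "'v set" and br :: "'v \<Rightarrow> 'v \<Rightarrow> 'v" and st :: "'v \<Rightarrow> 'v"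
    and k :: "'v \<Rightarrow> 'v \<Rightarrow> complex" and X :: "'v \<Rightarrow> int \<Rightarrow> 'w \<Rightarrow> 'w"
  assumes br_closed: "\<And>x y. x \<in> g \<Longrightarrow> y \<in> g \<Longrightarrow> br x y \<in> g"
    and st_closed: "\<And>x. x \<in> g \<Longrightarrow> st x \<in> g"
    and X_linear: "\<And>x n. x \<in> g \<Longrightarrow> Vector_Spaces.linear sm sm (X x n)"
    and X_commute: "\<And>x y m n w. x \<in> g \<Longrightarrow> y \<in> g \<Longrightarrow>
        X x m (X y n w) = X y n (X x m w) + X (br x y) (m + n) w +
          (if m + n = 0 then sm (of_int m * k x y) w else 0)"
    and X_adjoint: "\<And>x n u v. x \<in> g \<Longrightarrow> ip (X x n u) v = ip u (X (st x) (- n) v)"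
begin

lemma X_add: "x \<in> g \<Longrightarrow> X x n (u + v) = X x n u + X x n v"
  and X_scale: "x \<in> g \<Longrightarrow> X x n (sm a u) = sm a (X x n u)"
  and X_zero: "x \<in> g \<Longrightarrow> X x n 0 = 0"
  and X_sum: "x \<in> g \<Longrightarrow> X x n (sum F A) = (\<Sum>i\<in>A. X x n (F i))"
  using X_linear[of x n] unfolding linear_iff_module_hom
  by (auto simp: module_hom.add module_hom.scale module_hom.zero module_hom.sum)

text \<open>Plays the part of a Poincare-Birkhoff-Witt spanning set: only non-positive modes are
  applied to \<open>K\<close>.\<close>

inductive_set lowered :: "'w set \<Rightarrow> 'w set" for K where
  base: "u \<in> K \<Longrightarrow> u \<in> lowered K"
| add: "u \<in> lowered K \<Longrightarrow> v \<in> lowered K \<Longrightarrow> u + v \<in> lowered K"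
| scale: "u \<in> lowered K \<Longrightarrow> sm a u \<in> lowered K"
| act: "u \<in> lowered K \<Longrightarrow> x \<in> g \<Longrightarrow> n \<le> 0 \<Longrightarrow> X x n u \<in> lowered K"

text \<open>An arbitrary mode is moved to the right past the last mode applied. The commutator
  consists of a single mode and a scalar acting on a vector generated earlier, so the induction
  hypothesis, taken for all currents and all modes, covers it.\<close>

lemma lowered_invariant:
  assumes K: "\<And>u x n. u \<in> K \<Longrightarrow> x \<in> g \<Longrightarrow> n > 0 \<Longrightarrow> X x n u = 0"
    and "u \<in> lowered K" "x \<in> g"
  shows "X x n u \<in> lowered K"
  using assms(2,3)
proof (induction arbitrary: x n)
  case (base u)
  show ?case
  proof (cases "n \<le> 0")
    case True
    then show ?thesis using base by (intro lowered.act lowered.base)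
  next
    case False
    then have "X x n u = sm 0 u" using K base by simp
    then show ?thesis using base by (metis lowered.base lowered.scale)
  qed
next
  case (act u y m)
  have "sm (if n + m = 0 then of_int n * k x y else 0) u \<in> lowered K"
    using act.hyps by (intro lowered.scale)
  then have "(if n + m = 0 then sm (of_int n * k x y) u else 0) \<in> lowered K"
    by (simp split: if_splits)
  then show ?case
    unfolding X_commute[OF act.prems act.hyps(2)]
    by (intro lowered.add lowered.act act.IH act.hyps br_closed act.prems)
qed (simp_all add: X_add X_scale lowered.add lowered.scale)

end

locale affine_irreducible = affine_unitary +
  assumes irreducible: "irreducible_under sm {X x n | x n. x \<in> g} UNIV"
begin

lemma invariant_subspace_UNIV:
  assumes "subspace S" "\<And>x n u. x \<in> g \<Longrightarrow> u \<in> S \<Longrightarrow> X x n u \<in> S" "v \<in> S" "v \<noteq> 0"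
  shows "w \<in> S"
proof -
  have "S = {0} \<or> S = UNIV"
    using irreducible assms(1,2) unfolding irreducible_under_def by blast
  then show ?thesis using assms(3,4) by auto
qed

lemma lowered_UNIV:
  assumes "\<And>u x n. u \<in> K \<Longrightarrow> x \<in> g \<Longrightarrow> n > 0 \<Longrightarrow> X x n u = 0" and "v \<in> K" "v \<noteq> 0"
  shows "w \<in> lowered K"
proof (rule invariant_subspace_UNIV)
  have "0 \<in> lowered K"
    using lowered.scale[OF lowered.base[OF assms(2)], of 0] by simp
  then show "subspace (lowered K)"
    by (auto simp: subspace_def intro: lowered.add lowered.scale)
  show "X x n u \<in> lowered K" if "x \<in> g" "u \<in> lowered K" for x n u
    by (rule lowered_invariant[OF assms(1) that(2,1)])
  show "v \<in> lowered K" "v \<noteq> 0"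
    using assms(2,3) by (auto intro: lowered.base)
qed

text \<open>Induction over an irreducible module. The positive modes, which would lower the weight,
  never have to be examined.\<close>

lemma lowered_span_induct:
  assumes "\<And>u x n. u \<in> K \<Longrightarrow> x \<in> g \<Longrightarrow> n > 0 \<Longrightarrow> X x n u = 0" and "v \<in> K" "v \<noteq> 0"
    and "subspace S" "K \<subseteq> S" and S: "\<And>x n u. x \<in> g \<Longrightarrow> n \<le> 0 \<Longrightarrow> u \<in> S \<Longrightarrow> X x n u \<in> S"
  shows "w \<in> S"
proof -
  have "u \<in> S" if "u \<in> lowered K" for u
    using that by induction (use assms(4,5) S in \<open>auto simp: subspace_def\<close>)
  moreover have "w \<in> lowered K"
    by (rule lowered_UNIV[of K v]) (use assms(1-3) in auto)
  ultimately show ?thesis by blast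
qed

end

text \<open>A relation, since different expressions for the same vector might a priori have
  different images. Generating by non-positive modes only is what makes pairings with
  \<open>E\<close> computable: their adjoints map \<open>E\<close> into itself or kill it.\<close>

inductive intertwining_graph ::
    "(complex \<Rightarrow> 'm::ab_group_add \<Rightarrow> 'm) \<Rightarrow> (complex \<Rightarrow> 'w::ab_group_add \<Rightarrow> 'w) \<Rightarrow> 'v set \<Rightarrow>
     ('v \<Rightarrow> int \<Rightarrow> 'm \<Rightarrow> 'm) \<Rightarrow> ('v \<Rightarrow> int \<Rightarrow> 'w \<Rightarrow> 'w) \<Rightarrow> 'm set \<Rightarrow> ('m \<Rightarrow> 'w) \<Rightarrow>
     'm \<Rightarrow> 'w \<Rightarrow> bool"
  for sm sw g XM XW E \<phi> where
  base: "u \<in> E \<Longrightarrow> intertwining_graph sm sw g XM XW E \<phi> u (\<phi> u)"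
| add: "intertwining_graph sm sw g XM XW E \<phi> a b \<Longrightarrow> intertwining_graph sm sw g XM XW E \<phi> a' b' \<Longrightarrow>
    intertwining_graph sm sw g XM XW E \<phi> (a + a') (b + b')"
| scale: "intertwining_graph sm sw g XM XW E \<phi> a b \<Longrightarrow>
    intertwining_graph sm sw g XM XW E \<phi> (sm c a) (sw c b)"
| act: "intertwining_graph sm sw g XM XW E \<phi> a b \<Longrightarrow> x \<in> g \<Longrightarrow> n \<le> 0 \<Longrightarrow>
    intertwining_graph sm sw g XM XW E \<phi> (XM x n a) (XW x n b)"

definition isometric_intertwiner ::
    "(complex \<Rightarrow> 'm::ab_group_add \<Rightarrow> 'm) \<Rightarrow> (complex \<Rightarrow> 'w::ab_group_add \<Rightarrow> 'w) \<Rightarrow>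
     ('m \<Rightarrow> 'm \<Rightarrow> complex) \<Rightarrow> ('w \<Rightarrow> 'w \<Rightarrow> complex) \<Rightarrow> 'v set \<Rightarrow>
     ('v \<Rightarrow> int \<Rightarrow> 'm \<Rightarrow> 'm) \<Rightarrow> ('v \<Rightarrow> int \<Rightarrow> 'w \<Rightarrow> 'w) \<Rightarrow> ('m \<Rightarrow> 'w) \<Rightarrow> bool" where
  "isometric_intertwiner sm sw im iw g XM XW \<Phi> \<longleftrightarrow>
     Vector_Spaces.linear sm sw \<Phi> \<and> (\<forall>u v. iw (\<Phi> u) (\<Phi> v) = im u v) \<and>
     (\<forall>x\<in>g. \<forall>n u. \<Phi> (XM x n u) = XW x n (\<Phi> u))"

text \<open>The inner product of two vectors generated from \<open>E\<close> is computed from the commutation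
  relations and the inner product on \<open>E\<close> alone, so the submodule of \<open>M \<times> W\<close> generated by the graph
  of \<open>\<phi>\<close> is the graph of an isometry.\<close>

lemma isometric_extension:
  assumes M: "affine_irreducible sm im g br st k XM"
    and W: "affine_unitary sw iw g br st k XW"
    and E: "module.subspace sm E" "E \<noteq> {0}" "\<And>x u. x \<in> g \<Longrightarrow> u \<in> E \<Longrightarrow> XM x 0 u \<in> E"
      "\<And>x n u. x \<in> g \<Longrightarrow> n > 0 \<Longrightarrow> u \<in> E \<Longrightarrow> XM x n u = 0"
    and \<phi>: "linear_on sm sw E \<phi>" "\<And>x u. x \<in> g \<Longrightarrow> u \<in> E \<Longrightarrow> \<phi> (XM x 0 u) = XW x 0 (\<phi> u)"
      "\<And>u v. u \<in> E \<Longrightarrow> v \<in> E \<Longrightarrow> iw (\<phi> u) (\<phi> v) = im u v"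
      "\<And>x n u. x \<in> g \<Longrightarrow> n > 0 \<Longrightarrow> u \<in> E \<Longrightarrow> XW x n (\<phi> u) = 0"
  obtains \<Phi> where "isometric_intertwiner sm sw im iw g XM XW \<Phi>" "\<And>u. u \<in> E \<Longrightarrow> \<Phi> u = \<phi> u"
proof -
  interpret M: affine_irreducible sm im g br st k XM by fact
  interpret W: affine_unitary sw iw g br st k XW by fact
  define G where "G = intertwining_graph sm sw g XM XW E \<phi>"
  note G_simp = G_def[symmetric]
  note G_base = intertwining_graph.base[of _ E sm sw g XM XW \<phi>, unfolded G_simp]
    and G_add = intertwining_graph.add[of sm sw g XM XW E \<phi>, unfolded G_simp]
    and G_scale = intertwining_graph.scale[of sm sw g XM XW E \<phi>, unfolded G_simp]
    and G_act = intertwining_graph.act[of sm sw g XM XW E \<phi>, unfolded G_simp]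
    and G_induct = intertwining_graph.induct[of sm sw g XM XW E \<phi>, unfolded G_simp,
      consumes 1, case_names base add scale act]
  have zeroE: "0 \<in> E" using E(1) by (simp add: M.subspace_def)
  have G0: "G 0 0"
    using G_scale[OF G_base[OF zeroE], of 0] by simp
  have invariant: "G (XM x n a) (XW x n b)" if "G a b" "x \<in> g" for a b x n
    using that
  proof (induction arbitrary: x n rule: G_induct)
    case (base u)
    show ?case
    proof (cases "n \<le> 0")
      case True
      then show ?thesis using base by (intro G_act G_base)
    next
      case False
      then show ?thesis using base E(4) \<phi>(4) G0 by simp
    qed
  next
    case (act a b y m)
    have "G (sm (if n + m = 0 then of_int n * k x y else 0) a)
            (sw (if n + m = 0 then of_int n * k x y else 0) b)"
      using act.hyps by (intro G_scale)
    then have "G (if n + m = 0 then sm (of_int n * k x y) a else 0)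
                 (if n + m = 0 then sw (of_int n * k x y) b else 0)"
      by (simp split: if_splits)
    then show ?case
      unfolding M.X_commute[OF act.prems act.hyps(2)] W.X_commute[OF act.prems act.hyps(2)]
      by (intro G_add G_act act.IH act.hyps act.prems M.br_closed)
  qed (simp_all add: M.X_add W.X_add M.X_scale W.X_scale G_add G_scale)
  \<comment> \<open>For \<open>n < 0\<close> the adjoint mode is positive and kills both
    \<open>u\<close> and \<open>\<phi> u\<close>, so both sides are 0; for \<open>n = 0\<close> it
    keeps \<open>u\<close> in \<open>E\<close> and commutes with \<phi>.\<close>
  have pairing_E: "im a u = iw b (\<phi> u)" if "G a b" "u \<in> E" for a b u
    using that
  proof (induction arbitrary: u rule: G_induct)
    case (act a b x n)
    show ?case
    proof (cases "n = 0")
      case True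
      then show ?thesis
        using act.IH[OF E(3)[OF M.st_closed[OF act.hyps(2)] act.prems]] act.hyps act.prems
        by (simp add: M.X_adjoint W.X_adjoint \<phi>(2) M.st_closed)
    next
      case False
      then show ?thesis
        using act.hyps act.prems
        by (simp add: M.X_adjoint W.X_adjoint \<phi>(4) E(4) M.st_closed)
    qed
  qed (simp_all add: \<phi>(3) M.ip_add_left W.ip_add_left M.ip_scale_left W.ip_scale_left)
  \<comment> \<open>The adjoint of a non-positive mode lands on the second pair as a non-negative
    one; this is why \<open>invariant\<close> covers all modes.\<close>
  have isometric: "im a a' = iw b b'" if "G a b" "G a' b'" for a b a' b'
    using that
  proof (induction arbitrary: a' b' rule: G_induct)
    case (base u)
    then show ?case
      using pairing_E[of a' b' u] by (metis M.ip_commute W.ip_commute)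
  next
    case (act a b x n)
    then show ?case
      using act.IH[OF invariant[OF act.prems M.st_closed[OF act.hyps(2)]]]
      by (simp add: M.X_adjoint W.X_adjoint)
  qed (simp_all add: M.ip_add_left W.ip_add_left M.ip_scale_left W.ip_scale_left)
  \<comment> \<open>The difference of two images lies over 0, hence has norm 0, and positive
    definiteness of the target finishes.\<close>
  have functional: "b = b'" if "G a b" "G a b'" for a b b'
  proof -
    have "G (a + sm (-1) a) (b + sw (-1) b')" using that by (intro G_add G_scale)
    then have "G 0 (b - b')" by simp
    from isometric[OF this this] show ?thesis by simp
  qed
  have total: "\<exists>b. G a b" for a
  proof -
    obtain v where v: "v \<in> E" "v \<noteq> 0" using E(2) zeroE by auto
    have "a \<in> {a. \<exists>b. G a b}"
    proof (rule M.invariant_subspace_UNIV)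
      show "M.subspace {a. \<exists>b. G a b}"
        unfolding M.subspace_def mem_Collect_eq using G0 G_add G_scale by blast
    qed (use v invariant G_base in blast)+
    then show ?thesis by simp
  qed
  define \<Phi> where "\<Phi> a = (THE b. G a b)" for a
  have \<Phi>_G: "G a (\<Phi> a)" for a
    unfolding \<Phi>_def using total[of a] functional by (metis the_equality)
  have \<Phi>_eq: "\<Phi> a = b" if "G a b" for a b
    using functional[OF \<Phi>_G that] .
  show thesis
  proof
    have "Vector_Spaces.linear sm sw \<Phi>"
      by unfold_locales (auto intro!: \<Phi>_eq G_add G_scale \<Phi>_G)
    then show "isometric_intertwiner sm sw im iw g XM XW \<Phi>"
      unfolding isometric_intertwiner_def
      using isometric[OF \<Phi>_G \<Phi>_G] by (auto intro!: \<Phi>_eq invariant \<Phi>_G)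
  qed (simp add: \<Phi>_eq G_base)
qed

section \<open>Weak modules of unitary vertex operator algebras\<close>

lemma gbinomial_0_left: "(0 :: complex) gchoose l = (if l = 0 then 1 else 0)"
  by (cases l) simp_all

lemma gbinomial_1: "(1 :: complex) gchoose l = (if l \<le> 1 then 1 else 0)"
proof -
  have "(1 :: complex) gchoose l = of_nat (1 choose l)"
    using binomial_gbinomial[of 1 l, where 'a = complex] by simp
  then show ?thesis by (cases "l = 0"; cases "l = 1") simp_all
qed

text \<open>The case \<open>n = 0\<close>, Borcherds' commutator formula: \<open>0 gchoose l\<close>
  leaves only \<open>l = 0\<close> on the right.\<close>

lemma jacobi_commutator:
  assumes J: "jacobi_identity sk Yi Yj Yk A" and "vector_space sk"
  shows "Sum_any (\<lambda>l. sk (of_int m gchoose l) (A (Yi u (int l) w) (of_int m + s - of_nat l) w')) =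
         Yk u m (A w s w') - A w s (Yj u m w')"
proof -
  interpret vector_space sk by fact
  have "Sum_any (\<lambda>l. sk (of_int m gchoose l) (A (Yi u (0 + int l) w) (of_int m + s - of_nat l) w')) =
    Sum_any (\<lambda>l. sk ((-1) ^ l * (of_int 0 gchoose l)) (Yk u (m + 0 - int l) (A w (s + of_nat l) w'))) -
    Sum_any (\<lambda>l. sk ((-1) powi (0 + int l) * (of_int 0 gchoose l))
       (A w (of_int 0 + s - of_nat l) (Yj u (m + int l) w')))"
    using J unfolding jacobi_identity_def by blast
  also have "\<dots> = Yk u m (A w s w') - A w s (Yj u m w')"
    by (subst (1 2) Sum_any_at[of 0]) (simp_all add: gbinomial_0_left)
  finally show ?thesis by simp
qed

text \<open>The case \<open>m = 0\<close>, the associativity formula, which expresses modes of a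
  composite vector through those of its factors.\<close>

lemma jacobi_iterate:
  assumes J: "jacobi_identity sk Yi Yj Yk A" and "vector_space sk"
  shows "A (Yi u n w) s w' =
    Sum_any (\<lambda>l. sk ((-1) ^ l * (of_int n gchoose l)) (Yk u (n - int l) (A w (s + of_nat l) w'))) -
    Sum_any (\<lambda>l. sk ((-1) powi (n + int l) * (of_int n gchoose l))
       (A w (of_int n + s - of_nat l) (Yj u (int l) w')))"
proof -
  interpret vector_space sk by fact
  have "Sum_any (\<lambda>l. sk (of_int 0 gchoose l) (A (Yi u (n + int l) w) (of_int 0 + s - of_nat l) w')) =
    Sum_any (\<lambda>l. sk ((-1) ^ l * (of_int n gchoose l)) (Yk u (0 + n - int l) (A w (s + of_nat l) w'))) -
    Sum_any (\<lambda>l. sk ((-1) powi (n + int l) * (of_int n gchoose l))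
       (A w (of_int n + s - of_nat l) (Yj u (0 + int l) w')))"
    using J unfolding jacobi_identity_def by blast
  moreover have "Sum_any (\<lambda>l. sk (of_int 0 gchoose l) (A (Yi u (n + int l) w) (of_int 0 + s - of_nat l) w')) =
    A (Yi u n w) s w'"
    by (subst Sum_any_at[of 0]) (simp_all add: gbinomial_0_left)
  ultimately show ?thesis by simp
qed

lemma jacobi_commutator_0:
  assumes "jacobi_identity sk Yi Yj Yk A" and "vector_space sk"
  shows "Yk u 0 (A w s w') = A w s (Yj u 0 w') + A (Yi u 0 w) s w'"
proof -
  interpret vector_space sk by fact
  have "Sum_any (\<lambda>l. sk (of_int 0 gchoose l) (A (Yi u (int l) w) (of_int 0 + s - of_nat l) w')) =
      A (Yi u 0 w) s w'"
    by (subst Sum_any_at[of 0]) (simp_all add: gbinomial_0_left)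
  then show ?thesis using jacobi_commutator[OF assms, of 0 u w s w'] by (simp add: algebra_simps)
qed

text \<open>For \<open>u\<close> the conformal vector, mode 1 is L_0 and mode 0 is L_{-1}. The
  formula then ties the weight of \<open>A w s w'\<close> to the L_{-1}-derivative property, and it
  is used in both directions.\<close>

lemma jacobi_commutator_1:
  assumes "jacobi_identity sk Yi Yj Yk A" and "vector_space sk"
  shows "Yk u 1 (A w s w') = A w s (Yj u 1 w') + A (Yi u 0 w) (s + 1) w' + A (Yi u 1 w) s w'"
proof -
  interpret vector_space sk by fact
  have "Sum_any (\<lambda>l. sk (of_int 1 gchoose l) (A (Yi u (int l) w) (of_int 1 + s - of_nat l) w')) =
      A (Yi u 0 w) (s + 1) w' + A (Yi u 1 w) s w'"
    by (subst Sum_any_at2[of 0 1]) (auto simp: gbinomial_1 add.commute)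
  then show ?thesis using jacobi_commutator[OF assms, of 1 u w s w'] by (simp add: algebra_simps)
qed

lemma bilinear_modes_simps:
  assumes "bilinear_modes si sj sk A"
  shows "A (u + v) s w = A u s w + A v s w" "A (si a u) s w = sk a (A u s w)"
    "A u s (w + w') = A u s w + A u s w'" "A u s (sj a w) = sk a (A u s w)"
    "A 0 s w = 0" "A u s 0 = 0" "A (u - v) s w = A u s w - A v s w"
    "A (- u) s w = - A u s w" "A u s (w - w') = A u s w - A u s w'"
    "A (sum F I) s w = (\<Sum>i\<in>I. A (F i) s w)" "A u s (sum G J) = (\<Sum>i\<in>J. A u s (G i))"
proof -
  interpret l: Vector_Spaces.linear si sk "\<lambda>u. A u s w" for s w
    using assms by (simp add: bilinear_modes_def)
  interpret r: Vector_Spaces.linear sj sk "A u s" for u s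
    using assms by (simp add: bilinear_modes_def)
  show "A (u + v) s w = A u s w + A v s w" "A (si a u) s w = sk a (A u s w)"
    "A u s (w + w') = A u s w + A u s w'" "A u s (sj a w) = sk a (A u s w)"
    "A 0 s w = 0" "A u s 0 = 0" "A (u - v) s w = A u s w - A v s w"
    "A (- u) s w = - A u s w" "A u s (w - w') = A u s w - A u s w'"
    "A (sum F I) s w = (\<Sum>i\<in>I. A (F i) s w)" "A u s (sum G J) = (\<Sum>i\<in>J. A u s (G i))"
    by (simp_all add: l.add l.scale r.add r.scale l.zero r.zero l.diff r.diff l.neg l.sum r.sum)
qed

text \<open>The conformal vector is L_{-2} applied to the vacuum, so its weight and its being
  quasi-primary come from Virasoro relations on the vacuum: L_1 sends it to 3 L_{-1} vac =
  0.\<close>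

lemma
  assumes "unitary_VOA V"
  shows unitary_VOA_L_vac: "n \<ge> -1 \<Longrightarrow> vL V n (vac V) = 0"
    and unitary_VOA_conf_grade: "conf V \<in> vgrade V 2"
    and unitary_VOA_L1_conf: "vL V 1 (conf V) = 0"
    and unitary_VOA_antiaut_conf: "antiaut V (conf V) = conf V"
    and unitary_VOA_L0_antiaut: "vL V 0 (antiaut V v) = antiaut V (vL V 0 v)"
proof -
  have VOA: "VOA V" and aa: "antilinear_automorphism V (antiaut V)"
    using assms by (auto simp: unitary_VOA_def)
  interpret vector_space "smult V" using VOA by (simp add: VOA_def)
  have vac: "vop V v (-1) (vac V) = v" "n \<ge> 0 \<Longrightarrow> vop V v n (vac V) = 0" for v n
    using VOA by (auto simp: VOA_def)
  have bil: "bilinear_modes (smult V) (smult V) (smult V) (vop V)"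
    using VOA by (auto simp: VOA_def)
  have Lvac: "vL V n (vac V) = 0" if "n \<ge> -1" for n
    unfolding vL_def using that by (intro vac) simp
  then show "n \<ge> -1 \<Longrightarrow> vL V n (vac V) = 0" .
  have vir: "vL V m (vL V n w) - vL V n (vL V m w) = smult V (of_int (m - n)) (vL V (m + n) w) +
      (if m + n = 0 then smult V (charge V / 12 * of_int (m ^ 3 - m)) w else 0)" for m n w
    using VOA unfolding VOA_def virasoro_relations_def by blast
  have conf: "vL V (-2) (vac V) = conf V"
    unfolding vL_def using vac(1) by simp
  have L0: "vL V n 0 = 0" for n
    unfolding vL_def by (simp add: bilinear_modes_simps[OF bil])
  show "conf V \<in> vgrade V 2"
    using vir[of 0 "-2" "vac V"] Lvac[of 0] by (simp add: conf vgrade_def eigenspace_def L0)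
  show "vL V 1 (conf V) = 0"
    using vir[of 1 "-2" "vac V"] Lvac[of 1] Lvac[of "-1"] by (simp add: conf L0)
  show \<Theta>: "antiaut V (conf V) = conf V"
    using aa by (simp add: antilinear_automorphism_def)
  show "vL V 0 (antiaut V v) = antiaut V (vL V 0 v)"
    using aa \<Theta> by (simp add: antilinear_automorphism_def vL_def)
qed

text \<open>The conditions on the L_0-grading are left out, so that a VOA acting on itself and its
  modules are instances of one locale.\<close>

locale weak_unitary_module = ip_space sm ip
  for sm :: "complex \<Rightarrow> 'w::ab_group_add \<Rightarrow> 'w" and ip :: "'w \<Rightarrow> 'w \<Rightarrow> complex" +
  fixes V :: "'v::ab_group_add voa" and Y :: "'v \<Rightarrow> int \<Rightarrow> 'w \<Rightarrow> 'w"
  assumes unitary_V: "unitary_VOA V"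
    and bilinear: "bilinear_modes (smult V) sm sm Y"
    and truncated: "lower_truncated Y"
    and vacuum: "\<And>n w. Y (vac V) n w = (if n = -1 then w else 0)"
    and jacobi: "jacobi_identity sm (vop V) Y Y Y"
    and virasoro: "virasoro_relations sm (charge V) (\<lambda>n. Y (conf V) (n + 1))"
    and derivative: "\<And>v n w. Y (vL V (-1) v) n w = sm (- of_int n) (Y v (n - 1) w)"
    and invariant: "invariant_under V ip Y"
begin

lemmas Y_simps = bilinear_modes_simps[OF bilinear]

lemma Y_linear: "Vector_Spaces.linear sm sm (Y v n)"
  using bilinear by (simp add: bilinear_modes_def)

abbreviation L where "L n \<equiv> Y (conf V) (n + 1)"

text \<open>For a quasi-primary vector only the term \<open>k = 0\<close> of the exponential of L_1
  survives. It is applied to the conformal vector and to the currents.\<close>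

lemma primary_adjoint:
  assumes "v \<in> vgrade V d" "vL V 1 (antiaut V v) = 0"
  shows "ip (Y v m w1) w2 = (-1) powi d * ip w1 (Y (antiaut V v) (2 * d - m - 2) w2)"
proof -
  have "ip (Y v m w1) w2 = (-1) powi d *
      Sum_any (\<lambda>k. ip w1 (Y (smult V (1 / fact k) ((vL V 1 ^^ k) (antiaut V v)))
                           (2 * d - int k - m - 2) w2))"
    using invariant assms(1) unfolding invariant_under_def by blast
  also have "Sum_any (\<lambda>k. ip w1 (Y (smult V (1 / fact k) ((vL V 1 ^^ k) (antiaut V v)))
      (2 * d - int k - m - 2) w2)) = ip w1 (Y (antiaut V v) (2 * d - m - 2) w2)"
  proof (subst Sum_any_at[of 0])
    interpret VV: vector_space "smult V"
      using unitary_V by (simp add: unitary_VOA_def VOA_def)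
    have "bilinear_modes (smult V) (smult V) (smult V) (vop V)"
      using unitary_V by (simp add: unitary_VOA_def VOA_def)
    then have "vL V 1 0 = 0" by (simp add: vL_def bilinear_modes_simps)
    then have "(vL V 1 ^^ k) (antiaut V v) = 0" if "k \<noteq> 0" for k
      using that
    proof (induction k)
      case (Suc k)
      then show ?case by (cases "k = 0") (simp_all add: assms(2) \<open>vL V 1 0 = 0\<close>)
    qed simp
    then show "ip w1 (Y (smult V (1 / fact k) ((vL V 1 ^^ k) (antiaut V v)))
        (2 * d - int k - m - 2) w2) = 0" if "k \<noteq> 0" for k
      using that by (simp add: Y_simps)
    show "ip w1 (Y (smult V (1 / fact 0) ((vL V 1 ^^ 0) (antiaut V v))) (2 * d - int 0 - m - 2) w2) =
        ip w1 (Y (antiaut V v) (2 * d - m - 2) w2)" by simp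
  qed
  finally show ?thesis .
qed

lemma L_adjoint: "ip (L n w1) w2 = ip w1 (L (- n) w2)"
proof -
  have "vL V 1 (antiaut V (conf V)) = 0"
    using unitary_V by (simp add: unitary_VOA_antiaut_conf unitary_VOA_L1_conf)
  from primary_adjoint[OF unitary_VOA_conf_grade[OF unitary_V] this] show ?thesis
    using unitary_V by (simp add: unitary_VOA_antiaut_conf algebra_simps)
qed

lemma L0_self_adjoint: "ip (Y (conf V) 1 u) v = ip u (Y (conf V) 1 v)"
  using L_adjoint[of 0] by simp

lemma L_m1_commute:
  "Y (conf V) 0 (Y v n w) = Y v n (Y (conf V) 0 w) - sm (of_int n) (Y v (n - 1) w)"
  using jacobi_commutator_0[OF jacobi vector_space_axioms, of "conf V" v n w] derivative[of v n w]
  by (simp add: vL_def scale_minus_left)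

lemma L0_commute:
  assumes "v \<in> vgrade V d"
  shows "Y (conf V) 1 (Y v n w) = Y v n (Y (conf V) 1 w) + sm (of_int (d - n - 1)) (Y v n w)"
proof -
  have "vop V (conf V) 1 v = smult V (of_int d) v"
    using assms by (simp add: vgrade_def eigenspace_def vL_def)
  then show ?thesis
    using jacobi_commutator_1[OF jacobi vector_space_axioms, of "conf V" v n w] derivative[of v "n + 1" w]
    by (simp add: vL_def Y_simps algebra_simps)
qed

lemma L1_L_m1: "Y (conf V) 2 (Y (conf V) 0 w) = Y (conf V) 0 (Y (conf V) 2 w) + sm 2 (Y (conf V) 1 w)"
  using virasoro[unfolded virasoro_relations_def, rule_format, of 1 "-1" w]
  by (simp add: algebra_simps)

lemma L0_L1: "Y (conf V) 1 (Y (conf V) 2 w) = Y (conf V) 2 (Y (conf V) 1 w) - Y (conf V) 2 w"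
  using virasoro[unfolded virasoro_relations_def, rule_format, of 0 1 w]
  by (simp add: algebra_simps)

end

lemma unitary_VOA_weak_module:
  assumes "unitary_VOA V"
  shows "weak_unitary_module (smult V) (iprod V) V (vop V)"
  using assms unfolding weak_unitary_module_def weak_unitary_module_axioms_def ip_space_def
    ip_space_axioms_def by (simp add: unitary_VOA_def VOA_def vL_def[abs_def])

lemma unitary_module_weak_module:
  assumes "unitary_VOA V" "unitary_module V W"
  shows "weak_unitary_module (smult W) (iprod W) V (mop W)"
  using assms unfolding weak_unitary_module_def weak_unitary_module_axioms_def ip_space_def
    ip_space_axioms_def by (simp add: unitary_module_def VOA_module_def mL_def[abs_def])

section \<open>Current algebras in weight one\<close>

locale current_algebra =
  fixes V :: "'v::ab_group_add voa" and g :: "'v set"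
  assumes unitary: "unitary_VOA V" and CFT: "CFT_type V"
    and lie: "lie_subalgebra V g" and star_g: "star V ` g = g"
begin

sublocale VV: weak_unitary_module "smult V" "iprod V" V "vop V"
  by (rule unitary_VOA_weak_module) (rule unitary)

lemma g_grade: "x \<in> g \<Longrightarrow> x \<in> vgrade V 1"
  using lie by (auto simp: lie_subalgebra_def)

lemma vop_vac: "vop V v (-1) (vac V) = v" "n \<ge> 0 \<Longrightarrow> vop V v n (vac V) = 0"
  using unitary by (auto simp: unitary_VOA_def VOA_def)

lemma iprod_vac: "iprod V (vac V) (vac V) = 1"
  using unitary by (simp add: unitary_VOA_def)

lemma vgrade_0_eq: "v \<in> vgrade V 0 \<Longrightarrow> iprod V v (vac V) = c \<Longrightarrow> v = smult V c (vac V)"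
  using CFT by (auto simp: CFT_type_def VV.span_singleton VV.ip_scale_left iprod_vac)

lemma vgrade_neg: "v \<in> vgrade V n \<Longrightarrow> n < 0 \<Longrightarrow> v = 0"
  using CFT by (auto simp: CFT_type_def)

lemma antiaut_grade_1: "x \<in> vgrade V 1 \<Longrightarrow> antiaut V x \<in> vgrade V 1"
  using unitary
  by (simp add: vgrade_def eigenspace_def unitary_VOA_L0_antiaut)

text \<open>By CFT type L_1 x is a multiple of the vacuum, with coefficient the inner product of
  \<open>x\<close> with L_{-1} vac = 0.\<close>

lemma L1_grade_1:
  assumes "x \<in> vgrade V 1"
  shows "vL V 1 x = 0"
proof -
  have "vL V 1 x \<in> vgrade V 0"
    using VV.L0_L1[of x] assms by (simp add: vgrade_def eigenspace_def vL_def)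
  moreover have "iprod V (vL V 1 x) (vac V) = 0"
    using VV.L_adjoint[of 1 x "vac V"] unitary_VOA_L_vac[OF unitary, of "-1"] by (simp add: vL_def)
  ultimately have "vL V 1 x = smult V 0 (vac V)" by (rule vgrade_0_eq)
  then show ?thesis by simp
qed

lemma X_adjoint:
  assumes "weak_unitary_module sm ip V Y" "x \<in> g"
  shows "ip (Y x n u) v = ip u (Y (star V x) (- n) v)"
proof -
  interpret W: weak_unitary_module sm ip V Y by fact
  show ?thesis
    using W.primary_adjoint[OF g_grade L1_grade_1, OF assms(2) antiaut_grade_1[OF g_grade[OF assms(2)]], of n u v]
    by (simp add: star_def W.Y_simps W.ip_minus_right)
qed

lemma vop_g_grade:
  assumes "x \<in> g" "y \<in> g"
  shows "vop V x n y \<in> vgrade V (1 - n)"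
  using VV.L0_commute[OF g_grade[OF assms(1)], of n y] g_grade[OF assms(2)]
  by (simp add: vgrade_def eigenspace_def vL_def VV.Y_simps algebra_simps flip: VV.scale_left_distrib)

text \<open>The weight of \<open>vop V x n y\<close> is \<open>1 - n\<close>, so CFT type leaves a
  multiple of the vacuum for \<open>n = 1\<close> and nothing beyond. The multiple is found by
  moving \<open>x\<close> to the vacuum side of the inner product.\<close>

lemma vop_g_g:
  assumes "x \<in> g" "y \<in> g"
  shows "vop V x 1 y = smult V (iprod V y (star V x)) (vac V)" "n \<ge> 2 \<Longrightarrow> vop V x n y = 0"
proof -
  have "iprod V (vop V x 1 y) (vac V) = iprod V y (star V x)"
    using X_adjoint[OF VV.weak_unitary_module_axioms assms(1), of 1 y "vac V"]
    by (simp add: vop_vac)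
  then show "vop V x 1 y = smult V (iprod V y (star V x)) (vac V)"
    using vop_g_grade[OF assms, of 1] by (intro vgrade_0_eq) simp_all
  show "vop V x n y = 0" if "n \<ge> 2"
    using vgrade_neg[OF vop_g_grade[OF assms, of n]] that by simp
qed

lemma X_commutator:
  assumes "weak_unitary_module sm ip V Y" and xy: "x \<in> g" "y \<in> g"
  shows "Y x m (Y y n w) = Y y n (Y x m w) + Y (bracket V x y) (m + n) w +
    (if m + n = 0 then sm (of_int m * iprod V y (star V x)) w else 0)"
proof -
  interpret W: weak_unitary_module sm ip V Y by fact
  have "Sum_any (\<lambda>l. sm (of_int m gchoose l) (Y (vop V x (int l) y) (of_int m + n - of_nat l) w)) =
      Y (bracket V x y) (m + n) w + (if m + n = 0 then sm (of_int m * iprod V y (star V x)) w else 0)"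
    by (subst Sum_any_at2[of 0 1])
      (auto simp: vop_g_g[OF xy] W.Y_simps W.vacuum bracket_def)
  then show ?thesis
    using jacobi_commutator[OF W.jacobi W.vector_space_axioms, of m x y n w]
    by (simp add: algebra_simps)
qed

text \<open>Reconciles the central term produced by the Jacobi identity with the order of arguments
  in the affine relations. The commutator of the modes -1 of \<open>y\<close> and 1 of
  \<open>x\<close>, applied to the vacuum, evaluates to both.\<close>

lemma cocycle_symmetric:
  assumes "x \<in> g" "y \<in> g"
  shows "iprod V y (star V x) = iprod V x (star V y)"
proof -
  have "smult V (iprod V y (star V x)) (vac V) = smult V (iprod V x (star V y)) (vac V)"
    using X_commutator[OF VV.weak_unitary_module_axioms assms(2,1), of "-1" 1 "vac V"]
    by (simp add: vop_vac vop_g_g[OF assms] VV.Y_simps)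
  moreover have "vac V \<noteq> 0" using iprod_vac by auto
  ultimately show ?thesis by simp
qed

lemma affine_unitary_weak_module:
  assumes "weak_unitary_module sm ip V Y"
  shows "affine_unitary sm ip g (bracket V) (star V) (\<lambda>x y. iprod V x (star V y)) Y"
proof -
  interpret W: weak_unitary_module sm ip V Y by fact
  show ?thesis
  proof (intro affine_unitary.intro affine_unitary_axioms.intro)
    show "ip_space sm ip" ..
    show "bracket V x y \<in> g" if "x \<in> g" "y \<in> g" for x y
      using lie that by (simp add: lie_subalgebra_def)
    show "star V x \<in> g" if "x \<in> g" for x
      using star_g that by blast
    show "Vector_Spaces.linear sm sm (Y x n)" for x n
      by (rule W.Y_linear)
    show "ip (Y x n u) v = ip u (Y (star V x) (- n) v)" if "x \<in> g" for x n u v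
      by (rule X_adjoint[OF assms that])
    show "Y x m (Y y n w) = Y y n (Y x m w) + Y (bracket V x y) (m + n) w +
        (if m + n = 0 then sm (of_int m * iprod V x (star V y)) w else 0)"
      if "x \<in> g" "y \<in> g" for x y m n w
      using X_commutator[OF assms that] cocycle_symmetric[OF that] by simp
  qed
qed

end

section \<open>Energy gradings\<close>

context ip_space
begin

lemma orthogonal_sum_eq_0:
  assumes "finite A" "\<And>i j. i \<in> A \<Longrightarrow> j \<in> A \<Longrightarrow> i \<noteq> j \<Longrightarrow> ip (F i) (F j) = 0"
    and "sum F A = 0" "i \<in> A"
  shows "F i = 0"
proof -
  have "0 = ip (F i) (sum F A)" using assms(3) by simp
  also have "\<dots> = (\<Sum>j\<in>A. if j = i then ip (F i) (F i) else 0)"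
    unfolding ip_sum_right using assms(2,4) by (intro sum.cong) auto
  also have "\<dots> = ip (F i) (F i)" using assms(1,4) by simp
  finally show ?thesis by simp
qed

lemma internal_direct_sum_decompose:
  assumes "internal_direct_sum sm E"
  obtains A c where "finite A" "\<And>a. c a \<in> E a" "w = (\<Sum>a\<in>A. c a)"
proof -
  from assms obtain c where c: "is_decomposition E c w"
    unfolding internal_direct_sum_def by blast
  show thesis
  proof (rule that)
    show "finite {a. c a \<noteq> 0}" "\<And>a. c a \<in> E a" "w = (\<Sum>a | c a \<noteq> 0. c a)"
      using c by (auto simp: is_decomposition_def Sum_any.expand_set)
  qed
qed

end

lemma (in affine_unitary) span_X_closed:
  assumes "\<And>b. b \<in> B \<Longrightarrow> X x n b \<in> span B" "u \<in> span B" "x \<in> g"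
  shows "X x n u \<in> span B"
  using assms(2)
  by (induction rule: span_induct_alt)
    (simp_all add: X_zero X_add X_scale assms(1,3) span_add span_scale span_zero)

lemma (in affine_unitary) X_adjoint':
  "x \<in> g \<Longrightarrow> ip v (X x n u) = ip (X (st x) (- n) v) u"
  by (metis X_adjoint ip_commute)

locale energy_module = weak_unitary_module sm ip U Y + affine_irreducible sm ip g br st k "\<lambda>x. Y (\<iota> x)"
  for sm :: "complex \<Rightarrow> 'w::ab_group_add \<Rightarrow> 'w" and ip :: "'w \<Rightarrow> 'w \<Rightarrow> complex"
    and U :: "'u::ab_group_add voa" and Y :: "'u \<Rightarrow> int \<Rightarrow> 'w \<Rightarrow> 'w"
    and g :: "'v set" and br st k and \<iota> :: "'v \<Rightarrow> 'u" +
  fixes E0 :: "'w set"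
  assumes E0_subspace: "subspace E0" and E0_nonzero: "E0 \<noteq> {0}"
    and E0_killed: "\<And>x n u. x \<in> g \<Longrightarrow> n > 0 \<Longrightarrow> u \<in> E0 \<Longrightarrow> Y (\<iota> x) n u = 0"
    and E0_stable: "\<And>x u. x \<in> g \<Longrightarrow> u \<in> E0 \<Longrightarrow> Y (\<iota> x) 0 u \<in> E0"
    and L0_decomposition: "internal_direct_sum sm (eigenspace sm (Y (conf U) 1))"
    and L0_fin_dim: "\<And>a. fin_dim sm (eigenspace sm (Y (conf U) 1) a)"
begin

abbreviation eig where "eig \<equiv> eigenspace sm (Y (conf U) 1)"

text \<open>The Sugawara formula is not needed to find $[L_0,x(n)]$: the derivative property gives
  $[L_{-1},x(n)]$, its adjoint is $[L_1,x(n)]$, and $2L_0=[L_1,L_{-1}]$.\<close>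

lemma L1_X:
  assumes "x \<in> g"
  shows "Y (conf U) 2 (Y (\<iota> x) n w) = Y (\<iota> x) n (Y (conf U) 2 w) - sm (of_int n) (Y (\<iota> x) (n + 1) w)"
proof (rule ip_ext)
  fix u
  have adj: "ip u (Y (conf U) 2 v) = ip (Y (conf U) 0 u) v" for u v
    using L_adjoint[of "-1" u v] by simp
  have "ip u (Y (conf U) 2 (Y (\<iota> x) n w)) = ip (Y (\<iota> (st x)) (- n) (Y (conf U) 0 u)) w"
    by (simp add: adj X_adjoint'[OF assms])
  also have "Y (\<iota> (st x)) (- n) (Y (conf U) 0 u) =
      Y (conf U) 0 (Y (\<iota> (st x)) (- n) u) - sm (of_int n) (Y (\<iota> (st x)) (- (n + 1)) u)"
    by (simp add: L_m1_commute scale_minus_left)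
  also have "ip \<dots> w = ip u (Y (\<iota> x) n (Y (conf U) 2 w) - sm (of_int n) (Y (\<iota> x) (n + 1) w))"
    by (simp add: ip_diff_left ip_diff_right ip_scale_left ip_scale_right X_adjoint'[OF assms] adj)
  finally show "ip u (Y (conf U) 2 (Y (\<iota> x) n w)) = \<dots>" .
qed

lemma L0_X:
  assumes "x \<in> g"
  shows "Y (conf U) 1 (Y (\<iota> x) n w) = Y (\<iota> x) n (Y (conf U) 1 w) - sm (of_int n) (Y (\<iota> x) n w)"
proof -
  let ?X = "\<lambda>n. Y (\<iota> x) n" and ?n = "of_int n :: complex"
  have 1: "Y (conf U) 2 (Y (conf U) 0 (?X n w)) =
    ?X n (Y (conf U) 2 (Y (conf U) 0 w)) - sm ?n (?X (n + 1) (Y (conf U) 0 w)) -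
    sm ?n (?X (n - 1) (Y (conf U) 2 w)) + sm (?n * (?n - 1)) (?X n w)"
    by (simp add: L_m1_commute L1_X[OF assms] Y_simps scale_right_diff_distrib)
  have 2: "Y (conf U) 0 (Y (conf U) 2 (?X n w)) =
    ?X n (Y (conf U) 0 (Y (conf U) 2 w)) - sm ?n (?X (n - 1) (Y (conf U) 2 w)) -
    sm ?n (?X (n + 1) (Y (conf U) 0 w)) + sm (?n * (?n + 1)) (?X n w)"
    by (simp add: L_m1_commute L1_X[OF assms] Y_simps scale_right_diff_distrib)
  have "sm 2 (Y (conf U) 1 (?X n w)) =
      Y (conf U) 2 (Y (conf U) 0 (?X n w)) - Y (conf U) 0 (Y (conf U) 2 (?X n w))"
    by (simp add: L1_L_m1)
  \<comment> \<open>The terms with modes \<open>n + 1\<close> and \<open>n - 1\<close> occur in both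
    expressions and cancel; the coefficients n(n - 1) and n(n + 1) leave -2n.\<close>
  also have "\<dots> = ?X n (Y (conf U) 2 (Y (conf U) 0 w)) - ?X n (Y (conf U) 0 (Y (conf U) 2 w))
      + (sm (?n * (?n - 1)) (?X n w) - sm (?n * (?n + 1)) (?X n w))"
    unfolding 1 2 by simp
  also have "\<dots> = sm 2 (?X n (Y (conf U) 1 w) - sm ?n (?X n w))"
    unfolding scale_left_diff_distrib[symmetric]
    by (simp add: L1_L_m1 Y_simps scale_right_diff_distrib algebra_simps scale_minus_left)
  finally show ?thesis by simp
qed

section \<open>Singular vectors and the spectrum of L_0\<close>

lemma eig_X:
  assumes "x \<in> g" "w \<in> eig a"
  shows "Y (\<iota> x) n w \<in> eig (a - of_int n)"
  using assms(2) by (simp add: eigenspace_def L0_X[OF assms(1)] Y_simps scale_left_diff_distrib)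

lemma eig_orthogonal: "u \<in> eig a \<Longrightarrow> v \<in> eig b \<Longrightarrow> a \<noteq> b \<Longrightarrow> ip u v = 0"
  by (rule eigenspaces_orthogonal[OF L0_self_adjoint])

lemma eig_subspace: "subspace (eig a)"
  by (rule subspace_eigenspace[OF Y_linear])

text \<open>Contains \<open>E0\<close> and, unlike \<open>E0\<close>, is visibly closed under taking
  L_0-components.\<close>

definition singular :: "'w set" where
  "singular = {u. \<forall>x\<in>g. \<forall>n>0. Y (\<iota> x) n u = 0}"

lemma singular_generates:
  assumes "v \<in> singular" "v \<noteq> 0" "v \<in> eig a"
  shows "w \<in> span (\<Union>n::nat. eig (a + of_nat n))"
proof (rule lowered_span_induct[of "{v}" v])
  let ?B = "\<Union>n::nat. eig (a + of_nat n)"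
  show "{v} \<subseteq> span ?B"
    using assms(3) by (auto intro!: span_base UN_I[of 0])
  show "Y (\<iota> x) n u \<in> span ?B" if "x \<in> g" "n \<le> 0" "u \<in> span ?B" for x n u
    using that(3,1)
  proof (rule span_X_closed[rotated])
    fix b assume "b \<in> ?B"
    then obtain m :: nat where "b \<in> eig (a + of_nat m)" by auto
    from eig_X[OF that(1) this, of n] that(2)
    have "Y (\<iota> x) n b \<in> eig (a + of_nat (m + nat (- n)))" by (simp add: algebra_simps)
    then show "Y (\<iota> x) n b \<in> span ?B" by (intro span_base) blast
  qed
qed (use assms in \<open>auto simp: singular_def\<close>)

text \<open>Otherwise \<open>v'\<close> would be orthogonal to every eigenspace in the spanning
  family of \<open>singular_generates\<close>, hence to itself.\<close>

lemma singular_eigenvalue_le: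
  assumes "v \<in> singular" "v \<noteq> 0" "v \<in> eig a" "v' \<noteq> 0" "v' \<in> eig b"
  obtains n :: nat where "b = a + of_nat n"
proof (rule ccontr)
  assume "\<not> thesis"
  with that have ne: "a + of_nat n \<noteq> b" for n :: nat by metis
  have "ip u v' = 0" if "u \<in> (\<Union>n::nat. eig (a + of_nat n))" for u
    using that eig_orthogonal[OF _ assms(5) ne] by blast
  from ip_zero_on_span[OF this singular_generates[OF assms(1-3), of v']]
  show False using assms(4) by simp
qed

lemma singular_eigenvalue_unique:
  assumes "v \<in> singular" "v \<noteq> 0" "v \<in> eig a" "v' \<in> singular" "v' \<noteq> 0" "v' \<in> eig b"
  shows "a = b"
proof -
  obtain n :: nat where n: "b = a + of_nat n"
    using singular_eigenvalue_le[OF assms(1-3,5,6)] .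
  obtain m :: nat where m: "a = b + of_nat m"
    using singular_eigenvalue_le[OF assms(4-6,2,3)] .
  have "(of_nat (n + m) :: complex) = 0" using n m by (simp add: algebra_simps)
  then show ?thesis using n by (simp only: of_nat_eq_0_iff) simp
qed

text \<open>A fixed mode shifts all weights by the same amount, so the images of the components stay
  pairwise orthogonal and can only sum to 0 if each is 0.\<close>

lemma singular_components:
  assumes "finite A" "\<And>a. c a \<in> eig a" "u = (\<Sum>a\<in>A. c a)" "u \<in> singular" "a \<in> A"
  shows "c a \<in> singular"
proof -
  have "Y (\<iota> x) n (c a) = 0" if "x \<in> g" "n > 0" for x n
  proof (rule orthogonal_sum_eq_0[OF assms(1) _ _ assms(5)])
    show "ip (Y (\<iota> x) n (c i)) (Y (\<iota> x) n (c j)) = 0" if "i \<noteq> j" for i j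
      using that
      by (intro eig_orthogonal[OF eig_X[OF \<open>x \<in> g\<close> assms(2)] eig_X[OF \<open>x \<in> g\<close> assms(2)]]) simp
    show "(\<Sum>i\<in>A. Y (\<iota> x) n (c i)) = 0"
      using assms(3,4) that X_sum[OF that(1), of n c A] by (simp add: singular_def)
  qed
  then show ?thesis by (simp add: singular_def)
qed

lemma E0_singular: "u \<in> E0 \<Longrightarrow> u \<in> singular"
  using E0_killed by (auto simp: singular_def)

text \<open>The components of vectors of \<open>E0\<close> are singular, and each of two non-zero
  singular eigenvectors bounds the weight of the other from below, so only one weight occurs;
  self-adjointness makes it real.\<close>

lemma ex_lowest: "\<exists>d::real. E0 \<subseteq> eig (of_real d)"
proof -
  obtain u where u: "u \<in> E0" "u \<noteq> 0"
    using E0_nonzero E0_subspace by (auto simp: subspace_def)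
  obtain A c where A: "finite A" "\<And>a. c a \<in> eig a" "u = (\<Sum>a\<in>A. c a)"
    using internal_direct_sum_decompose[OF L0_decomposition] by metis
  then obtain a where a: "a \<in> A" "c a \<noteq> 0" using u(2) by (metis sum.neutral)
  have ca: "c a \<in> singular"
    using singular_components[OF A E0_singular[OF u(1)] a(1)] .
  have "w \<in> eig a" if w: "w \<in> E0" for w
  proof -
    obtain B e where B: "finite B" "\<And>a. e a \<in> eig a" "w = (\<Sum>a\<in>B. e a)"
      using internal_direct_sum_decompose[OF L0_decomposition] by metis
    have "e b \<in> eig a" if "b \<in> B" for b
    proof (cases "e b = 0")
      case False
      then have "a = b"
        using singular_eigenvalue_unique[OF ca a(2) A(2) _ False B(2)]
          singular_components[OF B E0_singular[OF w] that] by blast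
      then show ?thesis using B(2) by simp
    qed (use eig_subspace in \<open>auto simp: subspace_def\<close>)
    then show ?thesis unfolding B(3) by (intro subspace_sum eig_subspace)
  qed
  moreover have "cnj a = a"
    using eigenvalue_real[OF L0_self_adjoint A(2) a(2)] .
  then have "a = of_real (Re a)" by (simp add: complex_eq_iff)
  ultimately show ?thesis by (metis subsetI)
qed

definition lowest :: real where
  "lowest = (LEAST a::real. eig (of_real a) \<noteq> {0})"

lemma
  shows E0_eig_lowest: "E0 \<subseteq> eig (of_real lowest)"
    and eig_nonzero: "v \<noteq> 0 \<Longrightarrow> v \<in> eig a \<Longrightarrow> \<exists>n::nat. a = of_real lowest + of_nat n"
proof -
  obtain d :: real where d: "E0 \<subseteq> eig (of_real d)" using ex_lowest by blast
  obtain u where u: "u \<in> E0" "u \<noteq> 0"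
    using E0_nonzero E0_subspace by (auto simp: subspace_def)
  have *: "\<exists>n::nat. a = of_real d + of_nat n" if "v \<noteq> 0" "v \<in> eig a" for v a
    using singular_eigenvalue_le[OF E0_singular[OF u(1)] u(2) subsetD[OF d u(1)] that] by metis
  have "lowest = d"
    unfolding lowest_def
  proof (rule Least_equality)
    show "eig (of_real d) \<noteq> {0}" using d u by auto
    fix a :: real assume "eig (of_real a) \<noteq> {0}"
    then obtain v where "v \<noteq> 0" "v \<in> eig (of_real a)"
      using eig_subspace by (auto simp: subspace_def)
    from *[OF this] obtain n :: nat where "complex_of_real a = of_real d + of_nat n" by blast
    then have "complex_of_real a = of_real (d + of_nat n)" by simp
    then show "d \<le> a" by (simp only: of_real_eq_iff)
  qed
  then show "E0 \<subseteq> eig (of_real lowest)"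
    "v \<noteq> 0 \<Longrightarrow> v \<in> eig a \<Longrightarrow> \<exists>n::nat. a = of_real lowest + of_nat n"
    using d * by auto
qed

text \<open>Negative modes raise the weight strictly and zero modes preserve \<open>E0\<close>, so
  no vector of lowest weight arises outside \<open>E0\<close>. Hence a vector of lowest weight that
  is orthogonal to \<open>E0\<close> vanishes.\<close>

lemma span_E0_higher: "w \<in> span (E0 \<union> (\<Union>n::nat. eig (of_real lowest + of_nat (Suc n))))"
proof -
  let ?B = "E0 \<union> (\<Union>n::nat. eig (of_real lowest + of_nat (Suc n)))"
  obtain v where v: "v \<in> E0" "v \<noteq> 0"
    using E0_nonzero E0_subspace by (auto simp: subspace_def)
  have higher: "b \<in> ?B" if "b \<in> eig (of_real lowest + of_nat m)" "m > 0" for b m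
    using that by (cases m) auto
  show ?thesis
  proof (rule lowered_span_induct[OF E0_killed v])
    show "E0 \<subseteq> span ?B" using span_superset[of ?B] by auto
    show "Y (\<iota> x) n u \<in> span ?B" if "x \<in> g" "n \<le> 0" "u \<in> span ?B" for x n u
      using that(3,1)
    proof (rule span_X_closed[rotated])
      fix b assume b: "b \<in> ?B"
      show "Y (\<iota> x) n b \<in> span ?B"
      proof (cases "n = 0 \<and> b \<in> E0")
        case True
        then show ?thesis using E0_stable[OF that(1)] by (auto intro: span_base)
      next
        case False
        from b obtain m :: nat where m: "b \<in> eig (of_real lowest + of_nat m)" "m = 0 \<Longrightarrow> b \<in> E0"
        proof (cases "b \<in> E0")
          case True
          then have "b \<in> eig (of_real lowest + of_nat 0)" using E0_eig_lowest by auto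
          with True show ?thesis using that by blast
        next
          case False
          with b obtain n :: nat where "b \<in> eig (of_real lowest + of_nat (Suc n))" by blast
          then show ?thesis using that by blast
        qed
        with False that(2) have "m + nat (- n) > 0" by auto
        moreover have "Y (\<iota> x) n b \<in> eig (of_real lowest + of_nat (m + nat (- n)))"
          using eig_X[OF that(1) m(1), of n] that(2) by (simp add: algebra_simps)
        ultimately show ?thesis by (intro span_base higher)
      qed
    qed
  qed auto
qed

text \<open>The weight \<open>lowest - 1\<close> does not occur, so L_1 kills a lowest vector v, and
  the squared norm of L_{-1} v is 2 \<open>lowest\<close> times that of v.\<close>

lemma lowest_nonneg: "lowest \<ge> 0"
proof -
  obtain v where v: "v \<in> E0" "v \<noteq> 0"
    using E0_nonzero E0_subspace by (auto simp: subspace_def)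
  then have ev: "v \<in> eig (of_real lowest)" using E0_eig_lowest by auto
  have "Y (conf U) 2 v \<in> eig (of_real lowest - 1)"
    using L0_L1[of v] ev by (simp add: eigenspace_def Y_simps scale_left_diff_distrib)
  then have L1: "Y (conf U) 2 v = 0"
  proof (rule contrapos_pp)
    assume nz: "Y (conf U) 2 v \<noteq> 0"
    show "Y (conf U) 2 v \<notin> eig (of_real lowest - 1)"
    proof
      assume "Y (conf U) 2 v \<in> eig (of_real lowest - 1)"
      from eig_nonzero[OF nz this] obtain n :: nat
        where "(of_nat (Suc n) :: complex) = 0" by (auto simp: algebra_simps)
      then show False by (simp only: of_nat_eq_0_iff)
    qed
  qed
  have "ip (Y (conf U) 0 v) (Y (conf U) 0 v) = ip v (Y (conf U) 2 (Y (conf U) 0 v))"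
    using L_adjoint[of "-1" v "Y (conf U) 0 v"] by simp
  also have "\<dots> = 2 * of_real lowest * ip v v"
    using ev by (simp add: L1_L_m1 L1 Y_simps eigenspace_def ip_scale_right)
  finally have "0 \<le> 2 * lowest * Re (ip v v)"
    using ip_self_Re_nonneg[of "Y (conf U) 0 v"] by simp
  then show ?thesis using ip_pos[OF v(2)] by (simp add: zero_le_mult_iff)
qed

end

section \<open>Compression of modules\<close>

text \<open>Lower truncation in the form needed for Jacobi sums. As \<open>Sum_any\<close> is 0 on
  infinite supports, finiteness must be known before a linear map is moved inside.\<close>

lemma finite_support_shift:
  fixes s N :: real
  assumes "\<And>t. t \<ge> N \<Longrightarrow> F t = 0" and "\<And>l. F (s + of_nat l) = 0 \<Longrightarrow> f l = 0"
  shows "finite {l::nat. f l \<noteq> 0}"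
proof -
  obtain n :: nat where n: "N - s \<le> of_nat n" using real_arch_simple by blast
  have "{l. f l \<noteq> 0} \<subseteq> {..<n}"
  proof
    fix l assume "l \<in> {l. f l \<noteq> 0}"
    then have "\<not> N \<le> s + of_nat l" using assms by auto
    then have "real l < real n" using n by linarith
    then show "l \<in> {..<n}" by simp
  qed
  then show ?thesis by (rule finite_subset) simp
qed

lemma finite_support_shift_int:
  assumes "\<And>t::int. t \<ge> N \<Longrightarrow> F t = 0" and "\<And>l. F (s + int l) = 0 \<Longrightarrow> f l = 0"
  shows "finite {l::nat. f l \<noteq> 0}"
proof -
  have "{l. f l \<noteq> 0} \<subseteq> {..<nat (N - s)}"
  proof
    fix l assume "l \<in> {l. f l \<noteq> 0}"
    then have "\<not> N \<le> s + int l" using assms by auto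
    then show "l \<in> {..<nat (N - s)}" by simp
  qed
  then show ?thesis by (rule finite_subset) simp
qed

lemma component_eqI:
  assumes "internal_direct_sum sm E" "is_decomposition E c w"
  shows "component E w = c"
  unfolding component_def using assms by (auto simp: internal_direct_sum_def intro!: the1_equality)

text \<open>\<open>emb\<close> fixes the vacuum and commutes with the currents; it is not assumed to
  send \<open>conf U\<close> to \<open>conf V\<close>.\<close>

locale affine_embedding = current_algebra V g +
  UU: weak_unitary_module "smult U" "iprod U" U "vop U" +
  UI: affine_irreducible "smult U" "iprod U" g "bracket V" "star V" "\<lambda>x y. iprod V x (star V y)"
    "\<lambda>x. vop U (\<iota> x)"
  for V :: "'v::ab_group_add voa" and g and U :: "'u::ab_group_add voa" and \<iota> :: "'v \<Rightarrow> 'u" +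
  fixes emb :: "'u \<Rightarrow> 'v"
  assumes emb_linear: "Vector_Spaces.linear (smult U) (smult V) emb"
    and emb_X: "\<And>x n u. x \<in> g \<Longrightarrow> emb (vop U (\<iota> x) n u) = vop V x n (emb u)"
    and emb_vac: "emb (vac U) = vac V"
begin

lemma emb_simps: "emb (u + v) = emb u + emb v" "emb (smult U a u) = smult V a (emb u)" "emb 0 = 0"
proof -
  interpret Vector_Spaces.linear "smult U" "smult V" emb by (rule emb_linear)
  show "emb (u + v) = emb u + emb v" "emb (smult U a u) = smult V a (emb u)" "emb 0 = 0"
    by (simp_all add: add scale zero)
qed

text \<open>The common feature of the action of \<open>U\<close> on its modules and of the action of
  \<open>V\<close> pulled back along \<open>emb\<close>, with \<open>X\<close> giving the currents
  in either case.\<close>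

definition iterate_formula ::
    "(complex \<Rightarrow> 'w::ab_group_add \<Rightarrow> 'w) \<Rightarrow> ('v \<Rightarrow> int \<Rightarrow> 'w \<Rightarrow> 'w) \<Rightarrow> ('u \<Rightarrow> int \<Rightarrow> 'w \<Rightarrow> 'w) \<Rightarrow> bool" where
  "iterate_formula sk X Y \<longleftrightarrow> (\<forall>x\<in>g. \<forall>u n s w. Y (vop U (\<iota> x) n u) s w =
    Sum_any (\<lambda>l. sk ((-1) ^ l * (of_int n gchoose l)) (X x (n - int l) (Y u (s + int l) w))) -
    Sum_any (\<lambda>l. sk ((-1) powi (n + int l) * (of_int n gchoose l)) (Y u (n + s - int l) (X x (int l) w))))"

lemma iterate_formula_U:
  assumes "weak_unitary_module sm ip U Y"
  shows "iterate_formula sm (\<lambda>x. Y (\<iota> x)) Y"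
proof -
  interpret W: weak_unitary_module sm ip U Y by fact
  show ?thesis
    unfolding iterate_formula_def
    by (intro ballI allI jacobi_iterate[OF W.jacobi W.vector_space_axioms, simplified])
qed

lemma iterate_formula_V:
  assumes "weak_unitary_module sm ip V Y"
  shows "iterate_formula sm Y (\<lambda>u. Y (emb u))"
proof -
  interpret W: weak_unitary_module sm ip V Y by fact
  have "Y (emb (vop U (\<iota> x) n u)) s w =
    Sum_any (\<lambda>l. sm ((-1) ^ l * (of_int n gchoose l)) (Y x (n - int l) (Y (emb u) (s + int l) w))) -
    Sum_any (\<lambda>l. sm ((-1) powi (n + int l) * (of_int n gchoose l)) (Y (emb u) (n + s - int l) (Y x (int l) w)))"
    if "x \<in> g" for x u n s w
    unfolding emb_X[OF that]
    by (rule jacobi_iterate[OF W.jacobi W.vector_space_axioms, simplified])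
  then show ?thesis unfolding iterate_formula_def by blast
qed

text \<open>The iterate formula determines all modes of a module of \<open>U\<close> from those of the generating
  currents, so a linear map that intertwines the currents intertwines everything.\<close>

lemma intertwines_all_modes:
  assumes \<Psi>: "Vector_Spaces.linear sa sb \<Psi>"
    and A: "iterate_formula sa XA YA" "\<And>u w. \<exists>N. \<forall>n\<ge>N. YA u n w = 0" "\<And>x w. x \<in> g \<Longrightarrow> \<exists>N. \<forall>n\<ge>N. XA x n w = 0"
      "\<And>u v n w. YA (u + v) n w = YA u n w + YA v n w" "\<And>a u n w. YA (smult U a u) n w = sa a (YA u n w)"
      "\<And>x n. x \<in> g \<Longrightarrow> XA x n 0 = 0" "\<And>u n. YA u n 0 = 0"
    and B: "iterate_formula sb XB YB"
      "\<And>u v n w. YB (u + v) n w = YB u n w + YB v n w" "\<And>a u n w. YB (smult U a u) n w = sb a (YB u n w)"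
    and vac: "\<And>n w. \<Psi> (YA (vac U) n w) = YB (vac U) n (\<Psi> w)"
    and X: "\<And>x n w. x \<in> g \<Longrightarrow> \<Psi> (XA x n w) = XB x n (\<Psi> w)"
  shows "\<Psi> (YA u n w) = YB u n (\<Psi> w)"
proof -
  interpret \<Psi>: Vector_Spaces.linear sa sb \<Psi> by fact
  define S where "S = {u. \<forall>n w. \<Psi> (YA u n w) = YB u n (\<Psi> w)}"
  have "u \<in> S"
  proof (rule UI.invariant_subspace_UNIV)
    have "YA 0 n w = 0" "YB 0 n w' = 0" for n w w'
      using A(5)[of 0 0 n w] B(3)[of 0 0 n w'] by simp_all
    then show "UU.subspace S"
      by (auto simp: S_def UU.subspace_def A(4,5) B(2,3) \<Psi>.add \<Psi>.scale)
    show "vac U \<in> S" using vac by (simp add: S_def)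
    show "vac U \<noteq> 0"
      using UU.unitary_V by (metis UU.ip_zero_left unitary_VOA_def zero_neq_one)
  next
    fix x n u assume x: "x \<in> g" and u: "u \<in> S"
    have "\<Psi> (YA (vop U (\<iota> x) n u) s w) = YB (vop U (\<iota> x) n u) s (\<Psi> w)" for s w
    proof -
      \<comment> \<open>Finite support is required on the source side only: once \<Psi> is inside,
        the two sides agree summand by summand.\<close>
      let ?F = "\<lambda>l. sa ((-1) ^ l * (of_int n gchoose l)) (XA x (n - int l) (YA u (s + int l) w))"
      let ?G = "\<lambda>l. sa ((-1) powi (n + int l) * (of_int n gchoose l)) (YA u (n + s - int l) (XA x (int l) w))"
      obtain N where N: "\<And>n. n \<ge> N \<Longrightarrow> YA u n w = 0" using A(2) by blast
      have "finite {l. ?F l \<noteq> 0}"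
        by (rule finite_support_shift_int[of N "\<lambda>t. YA u t w" s]) (auto simp: N A(6)[OF x])
      then have F: "\<Psi> (Sum_any ?F) = Sum_any (\<lambda>l. \<Psi> (?F l))"
        by (intro Sum_any_hom) (auto simp: \<Psi>.add)
      obtain N' where N': "\<And>n. n \<ge> N' \<Longrightarrow> XA x n w = 0" using A(3)[OF x] by blast
      have "finite {l. ?G l \<noteq> 0}"
        by (rule finite_support_shift_int[of N' "\<lambda>t. XA x t w" 0]) (auto simp: N' A(7))
      then have G: "\<Psi> (Sum_any ?G) = Sum_any (\<lambda>l. \<Psi> (?G l))"
        by (intro Sum_any_hom) (auto simp: \<Psi>.add)
      have uS: "\<Psi> (YA u n w) = YB u n (\<Psi> w)" for n w using u by (simp add: S_def)
      show ?thesis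
        unfolding A(1)[unfolded iterate_formula_def, rule_format, OF x]
          B(1)[unfolded iterate_formula_def, rule_format, OF x]
        by (simp add: \<Psi>.diff F G \<Psi>.scale X[OF x] uS)
    qed
    then show "vop U (\<iota> x) n u \<in> S" by (simp add: S_def)
  qed
  then show ?thesis by (simp add: S_def)
qed

end

section \<open>Isometric embeddings of affine modules and their adjoints\<close>

locale energy_embedding = affine_embedding V g U \<iota> emb +
  M: energy_module sm ip U Y g "bracket V" "star V" "\<lambda>x y. iprod V x (star V y)" \<iota> E0 +
  W: weak_unitary_module sw iw V Z
  for V :: "'v::ab_group_add voa" and g and U :: "'u::ab_group_add voa" and \<iota> :: "'v \<Rightarrow> 'u"
    and emb :: "'u \<Rightarrow> 'v"
    and sm :: "complex \<Rightarrow> 'm::ab_group_add \<Rightarrow> 'm" and ip Y E0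
    and sw :: "complex \<Rightarrow> 'w::ab_group_add \<Rightarrow> 'w" and iw Z +
  fixes \<Phi> :: "'m \<Rightarrow> 'w" and a :: complex
  assumes \<Phi>: "isometric_intertwiner sm sw ip iw g (\<lambda>x. Y (\<iota> x)) Z \<Phi>"
    and \<Phi>_E0: "\<And>u. u \<in> E0 \<Longrightarrow> \<Phi> u \<in> eigenspace sw (Z (conf V) 1) a"
    and W_decomposition: "internal_direct_sum sw (eigenspace sw (Z (conf V) 1))"
begin

lemma \<Phi>_linear: "Vector_Spaces.linear sm sw \<Phi>"
  and \<Phi>_isometric: "iw (\<Phi> u) (\<Phi> v) = ip u v"
  and \<Phi>_X: "x \<in> g \<Longrightarrow> \<Phi> (Y (\<iota> x) n u) = Z x n (\<Phi> u)"
  using \<Phi> by (auto simp: isometric_intertwiner_def)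

lemma \<Phi>_simps: "\<Phi> (u + v) = \<Phi> u + \<Phi> v" "\<Phi> (sm c u) = sw c (\<Phi> u)" "\<Phi> 0 = 0"
  "\<Phi> (u - v) = \<Phi> u - \<Phi> v" "\<Phi> (sum F A) = (\<Sum>i\<in>A. \<Phi> (F i))"
proof -
  interpret Vector_Spaces.linear sm sw \<Phi> by (rule \<Phi>_linear)
  show "\<Phi> (u + v) = \<Phi> u + \<Phi> v" "\<Phi> (sm c u) = sw c (\<Phi> u)" "\<Phi> 0 = 0"
    "\<Phi> (u - v) = \<Phi> u - \<Phi> v" "\<Phi> (sum F A) = (\<Sum>i\<in>A. \<Phi> (F i))"
    by (simp_all add: add scale zero diff sum)
qed

abbreviation eigW where "eigW \<equiv> eigenspace sw (Z (conf V) 1)"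

lemma \<Phi>_modes: "\<Phi> (Y u n w) = Z (emb u) n (\<Phi> w)"
proof (rule intertwines_all_modes[OF \<Phi>_linear iterate_formula_U[OF M.weak_unitary_module_axioms]
      _ _ _ _ _ _ iterate_formula_V[OF W.weak_unitary_module_axioms]])
  show "\<exists>N. \<forall>n\<ge>N. Y u n w = 0" for u w
    using M.truncated by (auto simp: lower_truncated_def)
  then show "\<exists>N. \<forall>n\<ge>N. Y (\<iota> x) n w = 0" for x w .
qed (simp_all add: M.Y_simps W.Y_simps emb_simps emb_vac M.vacuum W.vacuum \<Phi>_X \<Phi>_simps)

text \<open>The scalar by which L_0 of the commutant, that is mode 1 of
  \<open>conf V - emb (conf U)\<close>, acts on the image of \<Phi>.\<close>

definition shift :: complex where "shift = a - of_real M.lowest"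

lemma a_real: "cnj a = a"
proof -
  obtain v where v: "v \<in> E0" "v \<noteq> 0"
    using M.E0_nonzero M.E0_subspace by (auto simp: M.subspace_def)
  then have "\<Phi> v \<noteq> 0" using \<Phi>_isometric[of v v] by auto
  then show ?thesis using W.eigenvalue_real[OF W.L0_self_adjoint \<Phi>_E0[OF v(1)]] by simp
qed

lemma \<Phi>_L0: "Z (conf V) 1 (\<Phi> u) = \<Phi> (Y (conf U) 1 u) + sw shift (\<Phi> u)"
proof -
  define S where "S = {u. Z (conf V) 1 (\<Phi> u) = \<Phi> (Y (conf U) 1 u) + sw shift (\<Phi> u)}"
  obtain v where v: "v \<in> E0" "v \<noteq> 0"
    using M.E0_nonzero M.E0_subspace by (auto simp: M.subspace_def)
  have "u \<in> S"
  proof (rule M.invariant_subspace_UNIV[OF _ _ _ v(2)])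
    show "M.subspace S"
      by (auto simp: S_def M.subspace_def \<Phi>_simps M.Y_simps W.Y_simps W.scale_right_distrib mult.commute)
    show "v \<in> S"
      using \<Phi>_E0[OF v(1)] M.E0_eig_lowest v(1)
      by (auto simp: S_def eigenspace_def shift_def \<Phi>_simps W.scale_left_diff_distrib subset_iff)
  next
    fix x n u assume x: "x \<in> g" and u: "u \<in> S"
    have "Z (conf V) 1 (Z x n (\<Phi> u)) = Z x n (Z (conf V) 1 (\<Phi> u)) - sw (of_int n) (Z x n (\<Phi> u))"
      using W.L0_commute[OF g_grade[OF x], of n "\<Phi> u"] by (simp add: W.scale_minus_left)
    also have "\<dots> = \<Phi> (Y (conf U) 1 (Y (\<iota> x) n u)) + sw shift (Z x n (\<Phi> u))"
      using u by (simp add: S_def W.Y_simps M.L0_X[OF x] \<Phi>_simps \<Phi>_X[OF x])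
    finally show "Y (\<iota> x) n u \<in> S" by (simp add: S_def \<Phi>_X[OF x])
  qed
  then show ?thesis by (simp add: S_def)
qed

lemma \<Phi>_eig: "u \<in> M.eig b \<Longrightarrow> \<Phi> u \<in> eigW (b + shift)"
  by (simp add: eigenspace_def \<Phi>_L0 \<Phi>_simps W.scale_left_distrib)

text \<open>A component of \<open>w\<close> of weight \<open>b\<close> pairs only with the
  finite-dimensional eigenspace of weight \<open>b - shift\<close>, where the Riesz representation
  applies; \<open>w\<close> has finitely many components.\<close>

lemma ex_adjoint_vector: "\<exists>v. \<forall>u. iw (\<Phi> u) w = ip u v"
proof -
  obtain B d where B: "finite B" "\<And>b. d b \<in> eigW b" "w = (\<Sum>b\<in>B. d b)"
    using W.internal_direct_sum_decompose[OF W_decomposition] by metis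
  have "\<exists>v. \<forall>u. iw (\<Phi> u) (d b) = ip u v" for b
  proof -
    have "\<exists>v\<in>M.eig (b - shift). \<forall>u\<in>M.eig (b - shift). iw (\<Phi> u) (d b) = ip u v"
      by (rule M.riesz_fin_dim[OF M.L0_fin_dim M.eig_subspace])
        (simp_all add: \<Phi>_simps W.ip_add_left W.ip_scale_left)
    then obtain v where v: "v \<in> M.eig (b - shift)"
      "\<And>u. u \<in> M.eig (b - shift) \<Longrightarrow> iw (\<Phi> u) (d b) = ip u v" by blast
    have on_eig: "iw (\<Phi> u) (d b) = ip u v" if "u \<in> M.eig e" for u e
    proof (cases "e = b - shift")
      case False
      then have "iw (\<Phi> u) (d b) = 0"
        by (intro W.eigenspaces_orthogonal[OF W.L0_self_adjoint \<Phi>_eig[OF that] B(2)])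
          (auto simp: algebra_simps)
      moreover have "ip u v = 0" using M.eig_orthogonal[OF that v(1) False] .
      ultimately show ?thesis by simp
    qed (use v that in auto)
    have "iw (\<Phi> u) (d b) = ip u v" for u
    proof -
      obtain A c where A: "finite A" "\<And>e. c e \<in> M.eig e" "u = (\<Sum>e\<in>A. c e)"
        using M.internal_direct_sum_decompose[OF M.L0_decomposition] by metis
      show ?thesis
        unfolding A(3) by (simp add: \<Phi>_simps W.ip_sum_left M.ip_sum_left on_eig[OF A(2)])
    qed
    then show ?thesis by blast
  qed
  then obtain v where "\<And>b u. iw (\<Phi> u) (d b) = ip u (v b)" by metis
  then have "\<forall>u. iw (\<Phi> u) w = ip u (\<Sum>b\<in>B. v b)"
    unfolding B(3) by (simp add: W.ip_sum_right M.ip_sum_right)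
  then show ?thesis by blast
qed

definition adj :: "'w \<Rightarrow> 'm" where
  "adj w = (SOME v. \<forall>u. iw (\<Phi> u) w = ip u v)"

lemma adj: "iw (\<Phi> u) w = ip u (adj w)"
  unfolding adj_def using someI_ex[OF ex_adjoint_vector] by blast

lemma adj_linear: "Vector_Spaces.linear sw sm adj"
proof -
  have "adj (v + w) = adj v + adj w" for v w
    by (rule M.ip_ext) (simp add: adj[symmetric] W.ip_add_right M.ip_add_right)
  moreover have "adj (sw c w) = sm c (adj w)" for c w
    by (rule M.ip_ext) (simp add: adj[symmetric] W.ip_scale_right M.ip_scale_right)
  ultimately show ?thesis by unfold_locales
qed

lemma adj_simps: "adj (u + v) = adj u + adj v" "adj (sw c u) = sm c (adj u)" "adj 0 = 0"
  "adj (u - v) = adj u - adj v"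
proof -
  interpret Vector_Spaces.linear sw sm adj by (rule adj_linear)
  show "adj (u + v) = adj u + adj v" "adj (sw c u) = sm c (adj u)" "adj 0 = 0"
    "adj (u - v) = adj u - adj v"
    by (simp_all add: add scale zero diff)
qed

lemma adj_X:
  assumes "x \<in> g"
  shows "adj (Z x n w) = Y (\<iota> x) n (adj w)"
proof (rule M.ip_ext)
  fix u
  interpret WA: affine_unitary sw iw g "bracket V" "star V" "\<lambda>x y. iprod V x (star V y)" Z
    by (rule affine_unitary_weak_module[OF W.weak_unitary_module_axioms])
  have "ip u (adj (Z x n w)) = iw (\<Phi> u) (Z x n w)"
    by (rule adj[symmetric])
  also have "\<dots> = iw (\<Phi> (Y (\<iota> (star V x)) (- n) u)) w"
    by (simp add: WA.X_adjoint'[OF assms] \<Phi>_X[OF M.st_closed[OF assms]])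
  also have "\<dots> = ip u (Y (\<iota> x) n (adj w))"
    by (simp add: adj M.X_adjoint'[OF assms])
  finally show "ip u (adj (Z x n w)) = \<dots>" .
qed

text \<open>Taking adjoints of \<open>\<Phi>_modes\<close> directly would involve L_1 of
  \<open>V\<close> on one side and of \<open>U\<close> on the other. Reducing to the currents, which
  are quasi-primary in \<open>V\<close>, avoids this comparison.\<close>

lemma adj_modes: "adj (Z (emb u) n w) = Y u n (adj w)"
proof (rule intertwines_all_modes[OF adj_linear iterate_formula_V[OF W.weak_unitary_module_axioms]
      _ _ _ _ _ _ iterate_formula_U[OF M.weak_unitary_module_axioms]])
  have *: "\<exists>N. \<forall>n\<ge>N. Z v n w = 0" for v w
    using W.truncated by (auto simp: lower_truncated_def)
  show "\<exists>N. \<forall>n\<ge>N. Z (emb u) n w = 0" "\<exists>N. \<forall>n\<ge>N. Z v n w = 0" for u v w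
    by (rule *)+
qed (simp_all add: M.Y_simps W.Y_simps emb_simps emb_vac M.vacuum W.vacuum adj_X adj_simps)

lemma adj_L0: "Y (conf U) 1 (adj w) = adj (Z (conf V) 1 w) - sm shift (adj w)"
proof (rule M.ip_ext)
  fix u
  have "cnj shift = shift" by (simp add: shift_def a_real)
  then show "ip u (Y (conf U) 1 (adj w)) = ip u (adj (Z (conf V) 1 w) - sm shift (adj w))"
    by (simp add: M.L0_self_adjoint[symmetric] W.L0_self_adjoint[symmetric] adj[symmetric]
        M.ip_diff_right M.ip_scale_right \<Phi>_L0 W.ip_add_left W.ip_scale_left)
qed

lemma adj_eig: "w \<in> eigW b \<Longrightarrow> adj w \<in> M.eig (b - shift)"
  by (simp add: eigenspace_def adj_L0 adj_simps M.scale_left_diff_distrib)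

text \<open>A formal adjoint on the lowest space is tested against \<open>E0\<close> only,
  \<open>adj\<close> against the whole module. For \<open>w\<close> of weight \<open>a\<close> the
  discrepancy has lowest weight, so it is orthogonal to all higher eigenspaces as well.\<close>

lemma adj_on_lowest:
  assumes "w \<in> eigW a" "p \<in> E0" and p: "\<And>u. u \<in> E0 \<Longrightarrow> iw (\<Phi> u) w = ip u p"
  shows "adj w = p"
proof -
  let ?B = "E0 \<union> (\<Union>n::nat. M.eig (of_real M.lowest + of_nat (Suc n)))"
  have eig: "adj w - p \<in> M.eig (of_real M.lowest)"
    using adj_eig[OF assms(1)] M.E0_eig_lowest assms(2)
    by (intro M.subspace_diff M.eig_subspace) (auto simp: shift_def)
  have "ip u (adj w - p) = 0" if "u \<in> ?B" for u
    using that
  proof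
    assume "u \<in> E0"
    then show ?thesis by (simp add: M.ip_diff_right p adj[symmetric])
  next
    assume "u \<in> (\<Union>n::nat. M.eig (of_real M.lowest + of_nat (Suc n)))"
    then obtain n :: nat where "u \<in> M.eig (of_real M.lowest + of_nat (Suc n))" by blast
    moreover have "of_real M.lowest + of_nat (Suc n) \<noteq> complex_of_real M.lowest"
      by (simp only: add_cancel_left_right of_nat_eq_0_iff)
    ultimately show ?thesis using M.eig_orthogonal[OF _ eig] by blast
  qed
  from M.ip_zero_on_span[OF this M.span_E0_higher[of "adj w - p"]] show ?thesis by simp
qed

text \<open>\<open>\<Phi> (adj w)\<close> is the orthogonal projection of \<open>w\<close> to the
  image of \<Phi>, and the complement has non-negative squared norm.\<close>

lemma adj_contraction: "Re (ip (adj w) (adj w)) \<le> Re (iw w w)"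
proof -
  let ?p = "\<Phi> (adj w)"
  have 1: "iw ?p w = ip (adj w) (adj w)" by (rule adj)
  have 2: "iw w ?p = ip (adj w) (adj w)"
    using W.ip_commute[of ?p w] M.ip_commute[of "adj w" "adj w"] by (simp add: 1)
  have "Re (iw (w - ?p) (w - ?p)) = Re (iw w w) - Re (ip (adj w) (adj w))"
    by (simp add: W.ip_diff_left W.ip_diff_right 1 2 \<Phi>_isometric)
  then show ?thesis using W.ip_self_Re_nonneg[of "w - ?p"] by linarith
qed

end

section \<open>Energy bounds\<close>

definition powr_L0 ::
    "(complex \<Rightarrow> 'w::ab_group_add \<Rightarrow> 'w) \<Rightarrow> ('w \<Rightarrow> 'w) \<Rightarrow> real \<Rightarrow> 'w \<Rightarrow> 'w" where
  "powr_L0 sm T r w =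
     Sum_any (\<lambda>a. sm ((1 + a) powr of_real r) (component (eigenspace sm T) w a))"

lemma one_plus_L0_powr_eq:
  "one_plus_L0_powr V W r = powr_L0 (smult W) (mop W (conf V) 1) r"
  by (simp add: fun_eq_iff one_plus_L0_powr_def powr_L0_def mL_def[abs_def])

lemma (in energy_module) ip_eig_sum:
  assumes "finite A" "\<And>b. d b \<in> eig b"
  shows "ip (\<Sum>b\<in>A. sm (\<alpha> b) (d b)) (\<Sum>b\<in>A. sm (\<alpha> b) (d b)) =
    of_real (\<Sum>b\<in>A. (cmod (\<alpha> b))\<^sup>2 * Re (ip (d b) (d b)))"
proof -
  have "ip (sm (\<alpha> b) (d b)) (\<Sum>b\<in>A. sm (\<alpha> b) (d b)) =
      of_real ((cmod (\<alpha> b))\<^sup>2 * Re (ip (d b) (d b)))" if "b \<in> A" for b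
  proof -
    have "ip (sm (\<alpha> b) (d b)) (\<Sum>b\<in>A. sm (\<alpha> b) (d b)) =
        (\<Sum>c\<in>A. if c = b then \<alpha> b * cnj (\<alpha> b) * ip (d b) (d b) else 0)"
      unfolding ip_sum_right
      by (intro sum.cong) (auto simp: ip_scale_left ip_scale_right eig_orthogonal[OF assms(2) assms(2)])
    also have "\<dots> = \<alpha> b * cnj (\<alpha> b) * ip (d b) (d b)" using assms(1) that by simp
    also have "\<dots> = of_real ((cmod (\<alpha> b))\<^sup>2 * Re (ip (d b) (d b)))"
      by (simp add: complex_eq_iff cmod_power2 power2_eq_square[of "Re _"] power2_eq_square[of "Im _"])
    finally show ?thesis .
  qed
  then show ?thesis unfolding ip_sum_left by simp
qed

context energy_embedding
begin

text \<open>On the image of \<open>\<Phi>\<close> the two energy operators differ by the constant \<open>shift\<close>, and the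
  spectrum of the smaller one is non-negative, so $1+a+\mathit{shift}$ is at most a multiple of
  $1+a$ in absolute value.\<close>

lemma powr_L0_bound:
  assumes "r \<ge> 0"
  shows "Re (iw (powr_L0 sw (Z (conf V) 1) r (\<Phi> u)) (powr_L0 sw (Z (conf V) 1) r (\<Phi> u))) \<le>
    ((1 + cmod shift) powr r)\<^sup>2 * Re (ip (powr_L0 sm (Y (conf U) 1) r u) (powr_L0 sm (Y (conf U) 1) r u))"
proof -
  obtain d where d: "is_decomposition M.eig d u"
    using M.L0_decomposition unfolding internal_direct_sum_def by blast
  define A where "A = {b. d b \<noteq> 0}"
  have A: "finite A" and d_eig: "\<And>b. d b \<in> M.eig b" and u: "u = (\<Sum>b\<in>A. d b)"
    using d by (auto simp: is_decomposition_def A_def Sum_any.expand_set)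
  have comp: "component M.eig u = d"
    by (rule component_eqI[OF M.L0_decomposition d])
  \<comment> \<open>The components of \<open>\<Phi> u\<close> are those of \<open>u\<close>, with
    weights translated by \<open>shift\<close>.\<close>
  define e where "e b = \<Phi> (d (b - shift))" for b
  have supp: "{b. e b \<noteq> 0} \<subseteq> (\<lambda>b. b + shift) ` A"
  proof
    fix b assume "b \<in> {b. e b \<noteq> 0}"
    then have "d (b - shift) \<noteq> 0" by (auto simp: e_def \<Phi>_simps)
    then show "b \<in> (\<lambda>b. b + shift) ` A" by (intro image_eqI[of _ _ "b - shift"]) (auto simp: A_def)
  qed
  have Sum_shift: "Sum_any F = (\<Sum>b\<in>A. F (b + shift))" if "\<And>b. e b = 0 \<Longrightarrow> F b = (0 :: 'w)" for F
  proof -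
    have "Sum_any F = sum F ((\<lambda>b. b + shift) ` A)"
      by (rule Sum_any.expand_superset) (use A supp that in auto)
    also have "\<dots> = (\<Sum>b\<in>A. F (b + shift))" by (subst sum.reindex) (auto simp: inj_on_def)
    finally show ?thesis .
  qed
  have "is_decomposition eigW e (\<Phi> u)"
    unfolding is_decomposition_def
  proof (intro conjI allI)
    show "e b \<in> eigW b" for b using \<Phi>_eig[OF d_eig[of "b - shift"]] by (simp add: e_def)
    show "finite {b. e b \<noteq> 0}" by (rule finite_subset[OF supp]) (simp add: A)
    show "\<Phi> u = Sum_any e" by (subst Sum_shift) (simp_all add: e_def u \<Phi>_simps)
  qed
  then have compW: "component eigW (\<Phi> u) = e"
    by (rule component_eqI[OF W_decomposition])
  define \<alpha> where "\<alpha> b = (1 + (b + shift)) powr complex_of_real r" for b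
  define \<beta> where "\<beta> b = (1 + b) powr complex_of_real r" for b
  have PM: "powr_L0 sm (Y (conf U) 1) r u = (\<Sum>b\<in>A. sm (\<beta> b) (d b))"
    unfolding powr_L0_def comp \<beta>_def
    by (rule Sum_any.expand_superset) (use A in \<open>auto simp: A_def\<close>)
  have PW: "powr_L0 sw (Z (conf V) 1) r (\<Phi> u) = \<Phi> (\<Sum>b\<in>A. sm (\<alpha> b) (d b))"
    unfolding powr_L0_def compW by (subst Sum_shift) (simp_all add: e_def \<alpha>_def \<Phi>_simps)
  have "(cmod (\<alpha> b))\<^sup>2 * Re (ip (d b) (d b)) \<le>
      ((1 + cmod shift) powr r)\<^sup>2 * ((cmod (\<beta> b))\<^sup>2 * Re (ip (d b) (d b)))" if "b \<in> A" for b
  proof -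
    obtain n :: nat where "b = of_real M.lowest + of_nat n"
      using M.eig_nonzero[OF _ d_eig[of b]] \<open>b \<in> A\<close> by (auto simp: A_def)
    then have b: "1 + b = of_real (1 + M.lowest + n)" by simp
    have "cmod (1 + b) = \<bar>1 + M.lowest + n\<bar>" unfolding b norm_of_real ..
    then have ge1: "cmod (1 + b) \<ge> 1" using M.lowest_nonneg by simp
    have "cmod (1 + (b + shift)) \<le> cmod (1 + b) + cmod shift"
      using norm_triangle_ineq[of "1 + b" shift] by (simp add: add.assoc)
    also have "\<dots> \<le> (1 + cmod shift) * cmod (1 + b)"
      using mult_left_mono[OF ge1, of "cmod shift"] by (simp add: algebra_simps)
    finally have "cmod (1 + (b + shift)) powr r \<le> ((1 + cmod shift) * cmod (1 + b)) powr r"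
      using assms by (intro powr_mono2) auto
    then have "cmod (\<alpha> b) \<le> (1 + cmod shift) powr r * cmod (\<beta> b)"
      by (simp add: \<alpha>_def \<beta>_def norm_powr_real_powr' powr_mult)
    then have "(cmod (\<alpha> b))\<^sup>2 \<le> ((1 + cmod shift) powr r)\<^sup>2 * (cmod (\<beta> b))\<^sup>2"
      by (metis norm_ge_zero power_mono power_mult_distrib)
    from mult_right_mono[OF this M.ip_self_Re_nonneg] show ?thesis by (simp add: mult.assoc)
  qed
  then have "(\<Sum>b\<in>A. (cmod (\<alpha> b))\<^sup>2 * Re (ip (d b) (d b))) \<le>
      ((1 + cmod shift) powr r)\<^sup>2 * (\<Sum>b\<in>A. (cmod (\<beta> b))\<^sup>2 * Re (ip (d b) (d b)))"
    unfolding sum_distrib_left by (rule sum_mono)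
  then show ?thesis
    unfolding PM PW \<Phi>_isometric M.ip_eig_sum[OF A d_eig] Re_complex_of_real .
qed

end

section \<open>Compression of intertwining operators\<close>

text \<open>In the commutator with L_0, L_{-1} \<open>w1\<close> appears at mode
  \<open>s + 1\<close> and contributes \<open>-(s + 1)\<close>; this is the origin of the final
  \<open>- 1\<close>.\<close>

lemma intertwining_operator_weight:
  assumes "intertwining_operator V W1 W2 W3 A" "vector_space (smult W1)" "vector_space (smult W3)"
    and "w1 \<in> eigenspace (smult W1) (mop W1 (conf V) 1) x"
    and "w2 \<in> eigenspace (smult W2) (mop W2 (conf V) 1) y"
  shows "A w1 s w2 \<in> eigenspace (smult W3) (mop W3 (conf V) 1) (x + y - of_real s - 1)"
proof -
  interpret W1: vector_space "smult W1" by fact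
  interpret W3: vector_space "smult W3" by fact
  note A = assms(1)[unfolded intertwining_operator_def]
  have bil: "bilinear_modes (smult W1) (smult W2) (smult W3) A" using A by blast
  have deriv: "A (mop W1 (conf V) 0 w1) (s + 1) w2 = smult W3 (- of_real (s + 1)) (A w1 s w2)"
  proof -
    have "A (mL V W1 (-1) w1) (s + 1) w2 = smult W3 (- of_real (s + 1)) (A w1 (s + 1 - 1) w2)"
      using A by blast
    then show ?thesis by (simp add: mL_def)
  qed
  have "jacobi_identity (smult W3) (mop W1) (mop W2) (mop W3) A" using A by blast
  from jacobi_commutator_1[OF this assms(3), of "conf V" w1 s w2] assms(4,5)
  have "mop W3 (conf V) 1 (A w1 s w2) =
      smult W3 y (A w1 s w2) + smult W3 (- of_real (s + 1)) (A w1 s w2) + smult W3 x (A w1 s w2)"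
    unfolding deriv by (simp add: eigenspace_def bilinear_modes_simps[OF bil])
  also have "\<dots> = smult W3 (x + y - of_real s - 1) (A w1 s w2)"
    unfolding W3.scale_left_distrib[symmetric] by (simp add: algebra_simps)
  finally show ?thesis by (simp add: eigenspace_def)
qed

locale compression =
  A: energy_embedding V g U \<iota> emb "smult M1" "iprod M1" "mop M1" E1 "smult W1" "iprod W1" "mop W1" \<Phi>1 a1 +
  B: energy_embedding V g U \<iota> emb "smult M2" "iprod M2" "mop M2" E2 "smult W2" "iprod W2" "mop W2" \<Phi>2 a2 +
  C: energy_embedding V g U \<iota> emb "smult M3" "iprod M3" "mop M3" E3 "smult W3" "iprod W3" "mop W3" \<Phi>3 a3
  for V :: "'v::ab_group_add voa" and g and U :: "'u::ab_group_add voa" and \<iota> emb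
    and M1 :: "('u, 'a::ab_group_add) amod" and E1 and W1 :: "('v, 'wi::ab_group_add) vmod" and \<Phi>1 a1
    and M2 :: "('u, 'b::ab_group_add) amod" and E2 and W2 :: "('v, 'wj::ab_group_add) vmod" and \<Phi>2 a2
    and M3 :: "('u, 'c::ab_group_add) amod" and E3 and W3 :: "('v, 'wk::ab_group_add) vmod" and \<Phi>3 a3 +
  fixes \<YY> :: "'wi \<Rightarrow> real \<Rightarrow> 'wj \<Rightarrow> 'wk" and \<kappa> :: real
  assumes \<YY>: "intertwining_operator V W1 W2 W3 \<YY>"
    and \<kappa>: "of_real \<kappa> = A.shift + B.shift - C.shift"
begin

text \<open>Multiplying by $x^{-\kappa}$ compensates for the energies that the commutant of the affine
  subalgebra contributes; without it the derivative property fails.\<close>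

definition compressed :: "'a \<Rightarrow> real \<Rightarrow> 'b \<Rightarrow> 'c" where
  "compressed u t v = C.adj (\<YY> (\<Phi>1 u) (t + \<kappa>) (\<Phi>2 v))"

lemma \<YY>_bilinear: "bilinear_modes (smult W1) (smult W2) (smult W3) \<YY>"
  and \<YY>_truncated: "lower_truncated \<YY>"
  and \<YY>_jacobi: "jacobi_identity (smult W3) (mop W1) (mop W2) (mop W3) \<YY>"
  using \<YY> by (auto simp: intertwining_operator_def)

lemmas \<YY>_simps = bilinear_modes_simps[OF \<YY>_bilinear]

lemma compressed_bilinear: "bilinear_modes (smult M1) (smult M2) (smult M3) compressed"
proof -
  have "Vector_Spaces.linear (smult M1) (smult M3) (\<lambda>u. compressed u t v)" for t v
    by unfold_locales (simp_all add: compressed_def A.\<Phi>_simps \<YY>_simps C.adj_simps)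
  moreover have "Vector_Spaces.linear (smult M2) (smult M3) (compressed u t)" for u t
    by unfold_locales (simp_all add: compressed_def B.\<Phi>_simps \<YY>_simps C.adj_simps)
  ultimately show ?thesis by (simp add: bilinear_modes_def)
qed

lemma compressed_truncated: "lower_truncated compressed"
  unfolding lower_truncated_def
proof (intro allI)
  fix u v
  obtain N where "\<And>s. s \<ge> N \<Longrightarrow> \<YY> (\<Phi>1 u) s (\<Phi>2 v) = 0"
    using \<YY>_truncated unfolding lower_truncated_def by blast
  then have "\<forall>t\<ge>N - \<kappa>. compressed u t v = 0"
    by (auto simp: compressed_def C.adj_simps)
  then show "\<exists>N. \<forall>t\<ge>N. compressed u t v = 0" by blast
qed

text \<open>The real index enters the Jacobi identity only additively, so translating it by \<kappa>
  is harmless for every \<kappa>.\<close>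

lemma compressed_jacobi: "jacobi_identity (smult M3) (mop M1) (mop M2) (mop M3) compressed"
  unfolding jacobi_identity_def
proof (intro allI)
  fix u w w' m n s
  let ?S1 = "\<lambda>l. smult W3 (of_int m gchoose l)
    (\<YY> (mop W1 (emb u) (n + int l) (\<Phi>1 w)) (of_int m + (s + \<kappa>) - of_nat l) (\<Phi>2 w'))"
  let ?S2 = "\<lambda>l. smult W3 ((-1) ^ l * (of_int n gchoose l))
    (mop W3 (emb u) (m + n - int l) (\<YY> (\<Phi>1 w) (s + \<kappa> + of_nat l) (\<Phi>2 w')))"
  let ?S3 = "\<lambda>l. smult W3 ((-1) powi (n + int l) * (of_int n gchoose l))
    (\<YY> (\<Phi>1 w) (of_int n + (s + \<kappa>) - of_nat l) (mop W2 (emb u) (m + int l) (\<Phi>2 w')))"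
  have J: "Sum_any ?S1 = Sum_any ?S2 - Sum_any ?S3"
    using \<YY>_jacobi unfolding jacobi_identity_def by blast
  obtain N where N: "\<And>t. t \<ge> N \<Longrightarrow> mop W1 (emb u) t (\<Phi>1 w) = 0"
    using A.W.truncated unfolding lower_truncated_def by blast
  have "finite {l. ?S1 l \<noteq> 0}"
    by (rule finite_support_shift_int[of N "\<lambda>t. mop W1 (emb u) t (\<Phi>1 w)" n]) (simp_all add: N \<YY>_simps)
  then have 1: "C.adj (Sum_any ?S1) = Sum_any (\<lambda>l. C.adj (?S1 l))"
    by (intro Sum_any_hom) (simp_all add: C.adj_simps)
  obtain N where N: "\<And>t. t \<ge> N \<Longrightarrow> \<YY> (\<Phi>1 w) t (\<Phi>2 w') = 0"
    using \<YY>_truncated unfolding lower_truncated_def by blast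
  have "finite {l. ?S2 l \<noteq> 0}"
    by (rule finite_support_shift[of N "\<lambda>t. \<YY> (\<Phi>1 w) t (\<Phi>2 w')" "s + \<kappa>"])
      (simp_all add: N C.W.Y_simps)
  then have 2: "C.adj (Sum_any ?S2) = Sum_any (\<lambda>l. C.adj (?S2 l))"
    by (intro Sum_any_hom) (simp_all add: C.adj_simps)
  obtain N where N: "\<And>t. t \<ge> N \<Longrightarrow> mop W2 (emb u) t (\<Phi>2 w') = 0"
    using B.W.truncated unfolding lower_truncated_def by blast
  have "finite {l. ?S3 l \<noteq> 0}"
    by (rule finite_support_shift_int[of N "\<lambda>t. mop W2 (emb u) t (\<Phi>2 w')" m]) (simp_all add: N \<YY>_simps)
  then have 3: "C.adj (Sum_any ?S3) = Sum_any (\<lambda>l. C.adj (?S3 l))"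
    by (intro Sum_any_hom) (simp_all add: C.adj_simps)
  have shift_add: "of_int p + (s + \<kappa>) - of_nat l = of_int p + s - of_nat l + \<kappa>"
      "s + \<kappa> + of_nat l = s + of_nat l + \<kappa>" for p l
    by simp_all
  have "Sum_any (\<lambda>l. C.adj (?S1 l)) = Sum_any (\<lambda>l. C.adj (?S2 l)) - Sum_any (\<lambda>l. C.adj (?S3 l))"
    using arg_cong[OF J, of C.adj] by (simp only: C.adj_simps 1 2 3)
  then show "Sum_any (\<lambda>l. smult M3 (of_int m gchoose l)
        (compressed (mop M1 u (n + int l) w) (of_int m + s - of_nat l) w')) =
      Sum_any (\<lambda>l. smult M3 ((-1) ^ l * (of_int n gchoose l))
        (mop M3 u (m + n - int l) (compressed w (s + of_nat l) w'))) -
      Sum_any (\<lambda>l. smult M3 ((-1) powi (n + int l) * (of_int n gchoose l))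
        (compressed w (of_int n + s - of_nat l) (mop M2 u (m + int l) w')))"
    by (simp only: compressed_def C.adj_simps C.adj_modes A.\<Phi>_modes B.\<Phi>_modes shift_add)
qed

lemma compressed_weight:
  assumes "u \<in> A.M.eig x" "v \<in> B.M.eig y"
  shows "compressed u t v \<in> C.M.eig (x + y - of_real t - 1)"
proof -
  have "\<YY> (\<Phi>1 u) (t + \<kappa>) (\<Phi>2 v) \<in>
      C.eigW ((x + A.shift) + (y + B.shift) - of_real (t + \<kappa>) - 1)"
    by (rule intertwining_operator_weight[OF \<YY> A.W.vector_space_axioms C.W.vector_space_axioms
          A.\<Phi>_eig[OF assms(1)] B.\<Phi>_eig[OF assms(2)]])
  from C.adj_eig[OF this] show ?thesis
    by (simp add: compressed_def \<kappa> algebra_simps)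
qed

text \<open>Not inherited from \<open>\<YY>\<close>, since \<Phi> relates L_{-1} of \<open>U\<close>
  to a mode of \<open>emb (conf U)\<close> and not to L_{-1} of \<open>V\<close>. Linearity reduces
  it to eigenvectors, where the weights are known.\<close>

lemma compressed_derivative:
  "compressed (mop M1 (conf U) 0 u) t v = smult M3 (- of_real t) (compressed u (t - 1) v)"
proof -
  note simps = bilinear_modes_simps[OF compressed_bilinear]
  have *: "compressed (mop M1 (conf U) 0 u) t v = smult M3 (- of_real t) (compressed u (t - 1) v)"
    if u: "u \<in> A.M.eig x" and v: "v \<in> B.M.eig y" for u v x y
  proof -
    have "mop M3 (conf U) 1 (compressed u (t - 1) v) =
        smult M3 (x + y - of_real t) (compressed u (t - 1) v)"
      using compressed_weight[OF u v, of "t - 1"] by (simp add: eigenspace_def)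
    \<comment> \<open>The L_0-commutator at mode \<open>t - 1\<close> has its L_{-1} term at mode
      \<open>t\<close>, for which it is solved.\<close>
    moreover have "compressed (mop M1 (conf U) 0 u) t v = mop M3 (conf U) 1 (compressed u (t - 1) v) -
        smult M3 y (compressed u (t - 1) v) - smult M3 x (compressed u (t - 1) v)"
      using jacobi_commutator_1[OF compressed_jacobi C.M.vector_space_axioms, of "conf U" u "t - 1" v] u v
      by (simp add: eigenspace_def simps)
    ultimately have "compressed (mop M1 (conf U) 0 u) t v =
        smult M3 (x + y - of_real t) (compressed u (t - 1) v) -
        smult M3 y (compressed u (t - 1) v) - smult M3 x (compressed u (t - 1) v)"
      by simp
    also have "\<dots> = smult M3 (- of_real t) (compressed u (t - 1) v)"
      unfolding C.M.scale_left_diff_distrib[symmetric] by simp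
    finally show ?thesis .
  qed
  obtain I c where I: "finite I" "\<And>x. c x \<in> A.M.eig x" "u = (\<Sum>x\<in>I. c x)"
    using A.M.internal_direct_sum_decompose[OF A.M.L0_decomposition] by metis
  obtain J d where J: "finite J" "\<And>x. d x \<in> B.M.eig x" "v = (\<Sum>x\<in>J. d x)"
    using B.M.internal_direct_sum_decompose[OF B.M.L0_decomposition] by metis
  show ?thesis
    unfolding I(3) J(3) simps A.M.Y_simps by (simp add: *[OF I(2) J(2)] C.M.scale_sum_right)
qed

lemma compressed_intertwining: "intertwining_operator U M1 M2 M3 compressed"
  unfolding intertwining_operator_def
  using compressed_bilinear compressed_truncated compressed_jacobi compressed_derivative
  by (simp add: mL_def)

lemma compressed_energy_bounds:
  assumes "energy_bounds V W2 W3 r (\<YY> (\<Phi>1 u))" "r \<ge> 0"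
  shows "energy_bounds U M2 M3 r (compressed u)"
proof -
  obtain K t where K: "K \<ge> 0" "t \<ge> 0" and bound: "\<And>s w. vnorm W3 (\<YY> (\<Phi>1 u) s w) \<le>
      K * (1 + \<bar>s\<bar>) powr t * vnorm W2 (one_plus_L0_powr V W2 r w)"
    using assms(1) unfolding energy_bounds_def by blast
  define D where "D = (1 + cmod B.shift) powr r"
  have D: "D \<ge> 0" by (simp add: D_def)
  have "vnorm M3 (compressed u s v) \<le>
      (K * (1 + \<bar>\<kappa>\<bar>) powr t * D) * (1 + \<bar>s\<bar>) powr t * vnorm M2 (one_plus_L0_powr U M2 r v)" for s v
  proof -
    have "vnorm M3 (compressed u s v) \<le> vnorm W3 (\<YY> (\<Phi>1 u) (s + \<kappa>) (\<Phi>2 v))"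
      unfolding vnorm_def compressed_def by (intro real_sqrt_le_mono C.adj_contraction)
    also have "\<dots> \<le> K * (1 + \<bar>s + \<kappa>\<bar>) powr t * vnorm W2 (one_plus_L0_powr V W2 r (\<Phi>2 v))"
      by (rule bound)
    also have "\<dots> \<le> K * ((1 + \<bar>\<kappa>\<bar>) powr t * (1 + \<bar>s\<bar>) powr t) *
        (D * vnorm M2 (one_plus_L0_powr U M2 r v))"
    proof (intro mult_mono)
      \<comment> \<open>A product bound turns the translation by \<kappa> into a constant
        factor.\<close>
      have "1 + \<bar>s + \<kappa>\<bar> \<le> (1 + \<bar>\<kappa>\<bar>) * (1 + \<bar>s\<bar>)"
      proof -
        have "1 + \<bar>s + \<kappa>\<bar> \<le> 1 + \<bar>\<kappa>\<bar> + \<bar>s\<bar> + \<bar>\<kappa>\<bar> * \<bar>s\<bar>"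
          using abs_triangle_ineq[of s \<kappa>] by (simp add: add_increasing2)
        then show ?thesis by (simp add: algebra_simps)
      qed
      then have "(1 + \<bar>s + \<kappa>\<bar>) powr t \<le> ((1 + \<bar>\<kappa>\<bar>) * (1 + \<bar>s\<bar>)) powr t"
        using K(2) by (intro powr_mono2) auto
      then show "(1 + \<bar>s + \<kappa>\<bar>) powr t \<le> (1 + \<bar>\<kappa>\<bar>) powr t * (1 + \<bar>s\<bar>) powr t"
        by (simp add: powr_mult)
      have "vnorm W2 (one_plus_L0_powr V W2 r (\<Phi>2 v)) \<le>
          sqrt (D\<^sup>2 * Re (iprod M2 (one_plus_L0_powr U M2 r v) (one_plus_L0_powr U M2 r v)))"
        unfolding vnorm_def one_plus_L0_powr_eq D_def
        by (intro real_sqrt_le_mono B.powr_L0_bound assms(2))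
      also have "\<dots> = D * vnorm M2 (one_plus_L0_powr U M2 r v)"
        using D by (simp add: real_sqrt_mult vnorm_def)
      finally show "vnorm W2 (one_plus_L0_powr V W2 r (\<Phi>2 v)) \<le> D * vnorm M2 (one_plus_L0_powr U M2 r v)" .
    qed (use K in \<open>auto simp: vnorm_def\<close>)
    finally show ?thesis by (simp add: mult_ac)
  qed
  moreover have "K * (1 + \<bar>\<kappa>\<bar>) powr t * D \<ge> 0" using K D by simp
  ultimately show ?thesis unfolding energy_bounds_def using K(2) by blast
qed

end

section \<open>Constructing the embeddings from the data of the theorem\<close>

lemma g_submodule_subset:
  assumes "module.subspace sm S" "w \<in> S" "\<And>x u. x \<in> g \<Longrightarrow> u \<in> S \<Longrightarrow> \<rho> x u \<in> S"
  shows "g_submodule g sm \<rho> w \<subseteq> S"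
  unfolding g_submodule_def using assms by blast

text \<open>The level absorbs \<open>f\<close> and \<open>l\<close> into the inner product of
  \<open>V\<close>, so affine modules and modules of \<open>V\<close> obey literally the same
  relations.\<close>

lemma (in current_algebra) is_L_affine_irreducible:
  assumes "is_level V g f l" "is_L V g h P f l lam W X E"
  shows "affine_irreducible (smult W) (iprod W) g (bracket V) (star V) (\<lambda>x y. iprod V x (star V y)) X"
proof -
  have rep: "affine_rep V g f l (smult W) X"
    and ip: "inner_product_on (smult W) UNIV (iprod W)"
    and adjoint: "\<And>x n u v. x \<in> g \<Longrightarrow> iprod W (X x n u) v = iprod W u (X (star V x) (- n) v)"
    and irr: "irreducible_under (smult W) {X x n | x n. x \<in> g} UNIV"
    using assms(2) by (auto simp: is_L_def)
  interpret vector_space "smult W" using rep by (simp add: affine_rep_def)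
  have closed: "star V x \<in> g" if "x \<in> g" for x using star_g that by blast
  show ?thesis
  proof (intro affine_irreducible.intro affine_unitary.intro affine_unitary_axioms.intro
      affine_irreducible_axioms.intro ip_space.intro ip_space_axioms.intro vector_space_axioms ip irr)
    show "bracket V x y \<in> g" if "x \<in> g" "y \<in> g" for x y
      using lie that by (simp add: lie_subalgebra_def)
    show "star V x \<in> g" if "x \<in> g" for x by (rule closed[OF that])
    show "Vector_Spaces.linear (smult W) (smult W) (X x n)" if "x \<in> g" for x n
      using rep that by (simp add: affine_rep_def)
    show "iprod W (X x n u) v = iprod W u (X (star V x) (- n) v)" if "x \<in> g" for x n u v
      by (rule adjoint[OF that])
    show "X x m (X y n w) = X y n (X x m w) + X (bracket V x y) (m + n) w +
        (if m + n = 0 then smult W (of_int m * iprod V x (star V y)) w else 0)"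
      if xy: "x \<in> g" "y \<in> g" for x y m n w
    proof -
      have level: "iprod V x (star V y) = f x (star V y) * of_real l"
        using assms(1) xy(1) closed[OF xy(2)] by (simp add: is_level_def)
      have "X x m (X y n w) - X y n (X x m w) = X (bracket V x y) (m + n) w +
          (if m = - n then smult W (of_int m * f x (star V y) * of_real l) w else 0)"
        using rep xy unfolding affine_rep_def by blast
      moreover have "m = - n \<longleftrightarrow> m + n = 0" by auto
      ultimately show ?thesis by (simp add: level mult.assoc algebra_simps)
    qed
  qed
qed

lemma is_L_lowest_space:
  assumes "is_L V g h P f l lam W X E"
  shows "module.subspace (smult W) (E 0)" "E 0 \<noteq> {0}"
    "\<And>x u. x \<in> g \<Longrightarrow> u \<in> E 0 \<Longrightarrow> X x 0 u \<in> E 0"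
    "\<And>x n u. x \<in> g \<Longrightarrow> n > 0 \<Longrightarrow> u \<in> E 0 \<Longrightarrow> X x n u = 0"
proof -
  have irr: "irreducible_under (smult W) {X x 0 | x. x \<in> g} (E 0)"
    and pos: "positive_energy_grading g (smult W) X E"
    using assms by (auto simp: is_L_def)
  show "module.subspace (smult W) (E 0)" "E 0 \<noteq> {0}"
    using irr by (auto simp: irreducible_under_def)
  show "X x 0 u \<in> E 0" if "x \<in> g" "u \<in> E 0" for x u
    using irr that unfolding irreducible_under_def by blast
  show "X x n u = 0" if "x \<in> g" "n > 0" "u \<in> E 0" for x n u
  proof -
    have "if n \<le> int 0 then X x n u \<in> E (nat (int 0 - n)) else X x n u = 0"
      using pos that unfolding positive_energy_grading_def by blast
    then show ?thesis using that(2) by simp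
  qed
qed

lemma (in current_algebra) ex_affine_embedding:
  assumes l: "is_level V g f l" and U: "affine_VOA V g h P f l U \<iota>"
  obtains emb where "affine_embedding V g U \<iota> emb"
proof -
  obtain E where E: "is_L V g h P f l (\<lambda>_. 0) U (\<lambda>x. vop U (\<iota> x)) E"
    and E0: "E 0 = module.span (smult U) {vac U}" and uU: "unitary_VOA U"
    using U by (auto simp: affine_VOA_def)
  note irr = is_L_affine_irreducible[OF l E]
  interpret UI: affine_irreducible "smult U" "iprod U" g "bracket V" "star V"
    "\<lambda>x y. iprod V x (star V y)" "\<lambda>x. vop U (\<iota> x)" by (rule irr)
  have vacU: "iprod U (vac U) (vac U) = 1" using uU by (simp add: unitary_VOA_def)
  \<comment> \<open>The functional reads off the coefficient of the vacuum, so on the lowest space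
    \<open>c\<close> times one vacuum goes to \<open>c\<close> times the other.\<close>
  define \<phi> where "\<phi> u = smult V (iprod U u (vac U)) (vac V)" for u
  have E0': "E 0 = range (\<lambda>c. smult U c (vac U))" unfolding E0 by (rule UI.span_singleton)
  have X0: "vop U (\<iota> x) 0 (smult U c (vac U)) = 0" if "x \<in> g" for x c
    using uU that by (simp add: UI.X_scale unitary_VOA_def VOA_def)
  obtain emb where emb: "isometric_intertwiner (smult U) (smult V) (iprod U) (iprod V) g
      (\<lambda>x. vop U (\<iota> x)) (vop V) emb" and emb_\<phi>: "\<And>u. u \<in> E 0 \<Longrightarrow> emb u = \<phi> u"
  proof (rule isometric_extension[OF irr affine_unitary_weak_module[OF VV.weak_unitary_module_axioms]
        is_L_lowest_space[OF E], where \<phi> = \<phi>])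
    show "linear_on (smult U) (smult V) (E 0) \<phi>"
      by (simp add: linear_on_def \<phi>_def UI.ip_add_left UI.ip_scale_left VV.scale_left_distrib)
    show "\<phi> (vop U (\<iota> x) 0 u) = vop V x 0 (\<phi> u)" if "x \<in> g" "u \<in> E 0" for x u
      using that by (auto simp: E0' \<phi>_def X0 VV.Y_simps vop_vac)
    show "iprod V (\<phi> u) (\<phi> v) = iprod U u v" if "u \<in> E 0" "v \<in> E 0" for u v
      using that by (auto simp: E0' \<phi>_def UI.ip_scale_left UI.ip_scale_right
          VV.ip_scale_left VV.ip_scale_right vacU iprod_vac)
    show "vop V x n (\<phi> u) = 0" if "n > 0" for x n u
      using that by (simp add: \<phi>_def VV.Y_simps vop_vac)
  qed blast+
  have "vac U \<in> E 0" unfolding E0 by (rule UI.span_base) simp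
  then have "emb (vac U) = vac V" by (simp add: emb_\<phi> \<phi>_def vacU)
  then have "affine_embedding V g U \<iota> emb"
    using emb unitary_VOA_weak_module[OF uU] irr current_algebra_axioms
    by (simp add: affine_embedding_def affine_embedding_axioms_def isometric_intertwiner_def)
  then show thesis by (rule that)
qed

text \<open>A single weight and annihilation by positive modes are given for \<open>w\<close> alone.
  Both conditions are stable under zero modes, hence hold on the whole image of \<phi>.\<close>

lemma (in affine_embedding) ex_energy_embedding:
  assumes l: "is_level V g f l" and W: "unitary_module V W"
    and w: "homogeneous V W w" "highest_weight_vector V g h P (smult W) (mop W) lam w"
    and M: "affine_module V g h P f l U \<iota> lam M"
    and \<phi>: "isometric_g_hom g \<iota> M W \<phi>" "\<phi> ` Lg M = g_submodule g (smult W) (\<lambda>x. mop W x 0) w"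
  obtains \<Phi> a where "energy_embedding V g U \<iota> emb (smult M) (iprod M) (mop M) (Lg M)
      (smult W) (iprod W) (mop W) \<Phi> a" "\<And>u. u \<in> Lg M \<Longrightarrow> \<Phi> u = \<phi> u"
proof -
  have uM: "unitary_module U M" and LM: "is_L V g h P f l lam M (\<lambda>x. mop M (\<iota> x)) (energy M)"
    using M by (auto simp: affine_module_def)
  note irr = is_L_affine_irreducible[OF l LM]
  note weakW = unitary_module_weak_module[OF unitary W]
  interpret W: weak_unitary_module "smult W" "iprod W" V "mop W" by (rule weakW)
  interpret WA: affine_unitary "smult W" "iprod W" g "bracket V" "star V"
    "\<lambda>x y. iprod V x (star V y)" "mop W" by (rule affine_unitary_weak_module[OF weakW])
  obtain a where a: "w \<in> eigenspace (smult W) (mop W (conf V) 1) a"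
    using w(1) by (auto simp: homogeneous_def mL_def[abs_def])
  let ?S = "{u \<in> eigenspace (smult W) (mop W (conf V) 1) a. \<forall>x\<in>g. \<forall>n>0. mop W x n u = 0}"
  have "g_submodule g (smult W) (\<lambda>x. mop W x 0) w \<subseteq> ?S"
  proof (rule g_submodule_subset)
    show "W.subspace ?S"
      using W.subspace_eigenspace[OF W.Y_linear, of "conf V" 1 a]
      by (simp add: W.subspace_def W.Y_simps)
    show "w \<in> ?S" using a w(2) by (simp add: highest_weight_vector_def)
    fix x u assume x: "x \<in> g" and u: "u \<in> ?S"
    have "mop W (conf V) 1 (mop W x 0 u) = smult W a (mop W x 0 u)"
      using W.L0_commute[OF g_grade[OF x], of 0 u] u by (simp add: eigenspace_def W.Y_simps)
    moreover have "mop W y n (mop W x 0 u) = 0" if "y \<in> g" "n > 0" for y n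
      using WA.X_commute[OF that(1) x, of n 0 u] that u WA.br_closed[OF that(1) x]
      by (simp add: W.Y_simps)
    ultimately show "mop W x 0 u \<in> ?S" by (simp add: eigenspace_def)
  qed
  then have \<phi>_S: "\<phi> u \<in> ?S" if "u \<in> Lg M" for u using that \<phi>(2) by blast
  note L0 = is_L_lowest_space[OF LM, folded Lg_def]
  obtain \<Phi> where \<Phi>: "isometric_intertwiner (smult M) (smult W) (iprod M) (iprod W) g
      (\<lambda>x. mop M (\<iota> x)) (mop W) \<Phi>" and \<Phi>_\<phi>: "\<And>u. u \<in> Lg M \<Longrightarrow> \<Phi> u = \<phi> u"
    by (rule isometric_extension[OF irr WA.affine_unitary_axioms L0, where \<phi> = \<phi>])
      (use \<phi>(1) \<phi>_S in \<open>auto simp: isometric_g_hom_def\<close>)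
  have "energy_module (smult M) (iprod M) U (mop M) g (bracket V) (star V)
      (\<lambda>x y. iprod V x (star V y)) \<iota> (Lg M)"
  proof (intro energy_module.intro energy_module_axioms.intro irr L0
      unitary_module_weak_module[OF UU.unitary_V uM])
    show "internal_direct_sum (smult M) (eigenspace (smult M) (mop M (conf U) 1))"
      "\<And>a. fin_dim (smult M) (eigenspace (smult M) (mop M (conf U) 1) a)"
      using uM by (auto simp: unitary_module_def VOA_module_def mL_def[abs_def])
  qed
  moreover have "internal_direct_sum (smult W) (eigenspace (smult W) (mop W (conf V) 1))"
    using W by (auto simp: unitary_module_def VOA_module_def mL_def[abs_def])
  ultimately have "energy_embedding V g U \<iota> emb (smult M) (iprod M) (mop M) (Lg M)
      (smult W) (iprod W) (mop W) \<Phi> a"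
    using \<Phi> \<phi>_S \<Phi>_\<phi> weakW affine_embedding_axioms
    by (simp add: energy_embedding_def energy_embedding_axioms_def)
  then show thesis using \<Phi>_\<phi> by (rule that)
qed

theorem theorem2p12:
  fixes V :: "'v::ab_group_add voa"
    and g h :: "'v set" and P :: "('v \<Rightarrow> complex) set"
    and f :: "'v \<Rightarrow> 'v \<Rightarrow> complex" and l :: real
    and Wi :: "('v, 'wi::ab_group_add) vmod"
    and Wj :: "('v, 'wj::ab_group_add) vmod"
    and Wk :: "('v, 'wk::ab_group_add) vmod"
    and lam mu nu :: "'v \<Rightarrow> complex"
    and w_lam :: 'wi and w_mu :: 'wj and w_nu :: 'wk
    and U :: "'u::ab_group_add voa" and \<iota> :: "'v \<Rightarrow> 'u"
    and L_lam :: "('u, 'a::ab_group_add) amod"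
    and L_mu :: "('u, 'b::ab_group_add) amod"
    and L_nu :: "('u, 'c::ab_group_add) amod"
    and \<phi>_lam :: "'a \<Rightarrow> 'wi" and \<phi>_mu :: "'b \<Rightarrow> 'wj" and \<phi>_nu :: "'c \<Rightarrow> 'wk"
    and \<phi>_nu_adj :: "'wk \<Rightarrow> 'c"
    and s :: real and \<YY> :: "'wi \<Rightarrow> real \<Rightarrow> 'wj \<Rightarrow> 'wk"
    and T :: "'a \<Rightarrow> 'b \<Rightarrow> 'c"
  assumes V: "unitary_VOA V" "CFT_type V"
    and g: "unitary_simple_lie_subalgebra V g"
    and h: "cartan_subalgebra V g h" "star V ` h = h"
    and P: "positive_roots V g h P"
    and f: "normalized_inner_product V g h f"
    and l: "is_level V g f l"
    and W: "unitary_module V Wi" "unitary_module V Wj" "unitary_module V Wk"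
    and w_lam: "homogeneous V Wi w_lam"
        "highest_weight_vector V g h P (smult Wi) (mop Wi) lam w_lam"
    and w_mu: "homogeneous V Wj w_mu"
        "highest_weight_vector V g h P (smult Wj) (mop Wj) mu w_mu"
    and w_nu: "homogeneous V Wk w_nu"
        "highest_weight_vector V g h P (smult Wk) (mop Wk) nu w_nu"
    and U: "affine_VOA V g h P f l U \<iota>"
    and L: "affine_module V g h P f l U \<iota> lam L_lam"
        "affine_module V g h P f l U \<iota> mu L_mu"
        "affine_module V g h P f l U \<iota> nu L_nu"
    and \<phi>_lam: "isometric_g_hom g \<iota> L_lam Wi \<phi>_lam"
        "\<phi>_lam ` Lg L_lam = g_submodule g (smult Wi) (\<lambda>x. mop Wi x 0) w_lam"
    and \<phi>_mu: "isometric_g_hom g \<iota> L_mu Wj \<phi>_mu"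
        "\<phi>_mu ` Lg L_mu = g_submodule g (smult Wj) (\<lambda>x. mop Wj x 0) w_mu"
    and \<phi>_nu: "isometric_g_hom g \<iota> L_nu Wk \<phi>_nu"
        "\<phi>_nu ` Lg L_nu = g_submodule g (smult Wk) (\<lambda>x. mop Wk x 0) w_nu"
    and \<phi>_nu_adj: "formal_adjoint L_nu Wk \<phi>_nu \<phi>_nu_adj"
    and \<YY>: "intertwining_operator V Wi Wj Wk \<YY>"
    and T: "T = (\<lambda>u v. \<phi>_nu_adj (\<YY> (\<phi>_lam u) s (\<phi>_mu v)))"
    and nonzero: "\<exists>u\<in>Lg L_lam. \<exists>v\<in>Lg L_mu. T u v \<noteq> 0"
  shows "T \<in> Hom_g g \<iota> L_lam L_mu L_nu \<and>
    (\<exists>\<Y>. intertwining_operator U L_lam L_mu L_nu \<Y> \<and>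
         (\<forall>u\<in>Lg L_lam. \<forall>v\<in>Lg L_mu. Psi U L_lam L_mu L_nu \<Y> u v = T u v) \<and>
         (\<forall>u\<in>Lg L_lam. \<forall>r\<ge>0.
            energy_bounds V Wj Wk r (\<YY> (\<phi>_lam u)) \<longrightarrow>
            energy_bounds U L_mu L_nu r (\<Y> u)))"
proof -
  have lie: "lie_subalgebra V g" "star V ` g = g"
    using g by (auto simp: unitary_simple_lie_subalgebra_def simple_lie_subalgebra_def)
  interpret current_algebra V g by unfold_locales (fact V lie)+
  obtain emb where "affine_embedding V g U \<iota> emb"
    using ex_affine_embedding[OF l U] .
  then interpret affine_embedding V g U \<iota> emb .
  obtain \<Phi>1 a1 where A: "energy_embedding V g U \<iota> emb (smult L_lam) (iprod L_lam) (mop L_lam) (Lg L_lam)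
      (smult Wi) (iprod Wi) (mop Wi) \<Phi>1 a1" and \<Phi>1: "\<And>u. u \<in> Lg L_lam \<Longrightarrow> \<Phi>1 u = \<phi>_lam u"
    by (rule ex_energy_embedding[OF l W(1) w_lam L(1) \<phi>_lam]) (rule that)
  obtain \<Phi>2 a2 where B: "energy_embedding V g U \<iota> emb (smult L_mu) (iprod L_mu) (mop L_mu) (Lg L_mu)
      (smult Wj) (iprod Wj) (mop Wj) \<Phi>2 a2" and \<Phi>2: "\<And>u. u \<in> Lg L_mu \<Longrightarrow> \<Phi>2 u = \<phi>_mu u"
    by (rule ex_energy_embedding[OF l W(2) w_mu L(2) \<phi>_mu]) (rule that)
  obtain \<Phi>3 a3 where C: "energy_embedding V g U \<iota> emb (smult L_nu) (iprod L_nu) (mop L_nu) (Lg L_nu)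
      (smult Wk) (iprod Wk) (mop Wk) \<Phi>3 a3" and \<Phi>3: "\<And>u. u \<in> Lg L_nu \<Longrightarrow> \<Phi>3 u = \<phi>_nu u"
    by (rule ex_energy_embedding[OF l W(3) w_nu L(3) \<phi>_nu]) (rule that)
  interpret A: energy_embedding V g U \<iota> emb "smult L_lam" "iprod L_lam" "mop L_lam" "Lg L_lam"
    "smult Wi" "iprod Wi" "mop Wi" \<Phi>1 a1 by (rule A)
  interpret B: energy_embedding V g U \<iota> emb "smult L_mu" "iprod L_mu" "mop L_mu" "Lg L_mu"
    "smult Wj" "iprod Wj" "mop Wj" \<Phi>2 a2 by (rule B)
  interpret C: energy_embedding V g U \<iota> emb "smult L_nu" "iprod L_nu" "mop L_nu" "Lg L_nu"
    "smult Wk" "iprod Wk" "mop Wk" \<Phi>3 a3 by (rule C)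
  have weight: "\<YY> (\<phi>_lam u) s (\<phi>_mu v) \<in> C.eigW (a1 + a2 - of_real s - 1)"
    if "u \<in> Lg L_lam" "v \<in> Lg L_mu" for u v
    using intertwining_operator_weight[OF \<YY> A.W.vector_space_axioms C.W.vector_space_axioms
        A.\<Phi>_E0[OF that(1)] B.\<Phi>_E0[OF that(2)], of s]
    by (simp add: \<Phi>1[OF that(1)] \<Phi>2[OF that(2)])
  have adj_in: "\<phi>_nu_adj w \<in> Lg L_nu"
    and adj: "u \<in> Lg L_nu \<Longrightarrow> iprod Wk (\<Phi>3 u) w = iprod L_nu u (\<phi>_nu_adj w)" for u w
    using \<phi>_nu_adj \<Phi>3 by (auto simp: formal_adjoint_def)
  \<comment> \<open>Otherwise the image is orthogonal to the lowest energy space of \<open>L_nu\<close> and the compressed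
     map vanishes.\<close>
  have s: "a1 + a2 - of_real s - 1 = a3"
  proof (rule ccontr)
    assume ne: "a1 + a2 - of_real s - 1 \<noteq> a3"
    obtain u v where uv: "u \<in> Lg L_lam" "v \<in> Lg L_mu" "T u v \<noteq> 0" using nonzero by blast
    have "iprod Wk (\<Phi>3 (T u v)) (\<YY> (\<phi>_lam u) s (\<phi>_mu v)) = 0"
      using ne by (intro C.W.eigenspaces_orthogonal[OF C.W.L0_self_adjoint
            C.\<Phi>_E0 weight[OF uv(1,2)]]) (auto simp: T adj_in)
    then have "iprod L_nu (T u v) (T u v) = 0" by (simp add: adj adj_in T)
    with uv(3) show False by simp
  qed
  \<comment> \<open>Chosen so that the mode read off by \<open>Psi\<close> becomes the mode
    \<open>s\<close> of \<open>\<YY>\<close>; the relation \<open>s\<close> makes it the required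
    combination of shifts.\<close>
  define \<kappa> where "\<kappa> = s - (Delta U L_lam + Delta U L_mu - Delta U L_nu - 1)"
  have Delta: "Delta U L_lam = A.M.lowest" "Delta U L_mu = B.M.lowest" "Delta U L_nu = C.M.lowest"
    by (simp_all add: Delta_def A.M.lowest_def B.M.lowest_def C.M.lowest_def mL_def[abs_def])
  interpret compression V g U \<iota> emb L_lam "Lg L_lam" Wi \<Phi>1 a1 L_mu "Lg L_mu" Wj \<Phi>2 a2
    L_nu "Lg L_nu" Wk \<Phi>3 a3 \<YY> \<kappa>
  proof unfold_locales
    show "intertwining_operator V Wi Wj Wk \<YY>" by (rule \<YY>)
    show "of_real \<kappa> = A.shift + B.shift - C.shift"
      using s by (simp add: \<kappa>_def A.shift_def B.shift_def C.shift_def Delta algebra_simps)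
  qed
  have Psi_T: "Psi U L_lam L_mu L_nu compressed u v = T u v"
    if "u \<in> Lg L_lam" "v \<in> Lg L_mu" for u v
  proof -
    let ?w = "\<YY> (\<phi>_lam u) s (\<phi>_mu v)"
    have "C.adj ?w = \<phi>_nu_adj ?w"
      using weight[OF that] by (intro C.adj_on_lowest adj adj_in) (simp_all add: s)
    moreover have "Delta U L_lam + Delta U L_mu - Delta U L_nu - 1 + \<kappa> = s"
      by (simp add: \<kappa>_def)
    ultimately show ?thesis
      by (simp add: Psi_def compressed_def T \<Phi>1[OF that(1)] \<Phi>2[OF that(2)])
  qed
  \<comment> \<open>On the lowest spaces \<open>T\<close> is a mode of \<open>compressed\<close>, so
    equivariance is its commutator formula with zero modes of currents.\<close>
  have Hom: "T \<in> Hom_g g \<iota> L_lam L_mu L_nu"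
  proof -
    note simps = bilinear_modes_simps[OF compressed_bilinear]
    note sub = A.M.E0_subspace[unfolded A.M.subspace_def] B.M.E0_subspace[unfolded B.M.subspace_def]
    have T': "T u v = compressed u (Delta U L_lam + Delta U L_mu - Delta U L_nu - 1) v"
      if "u \<in> Lg L_lam" "v \<in> Lg L_mu" for u v
      using Psi_T[OF that] by (simp add: Psi_def)
    have "T (mop L_lam (\<iota> x) 0 u) v + T u (mop L_mu (\<iota> x) 0 v) = mop L_nu (\<iota> x) 0 (T u v)"
      if "x \<in> g" "u \<in> Lg L_lam" "v \<in> Lg L_mu" for x u v
      using that jacobi_commutator_0[OF compressed_jacobi C.M.vector_space_axioms]
      by (simp add: T' A.M.E0_stable B.M.E0_stable)
    moreover have "T u v \<in> Lg L_nu" for u v by (simp add: T adj_in)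
    moreover have "\<forall>v\<in>Lg L_mu. linear_on (smult L_lam) (smult L_nu) (Lg L_lam) (\<lambda>u. T u v)"
      "\<forall>u\<in>Lg L_lam. linear_on (smult L_mu) (smult L_nu) (Lg L_mu) (T u)"
      using sub by (simp_all add: linear_on_def T' simps)
    ultimately show ?thesis unfolding Hom_g_def by blast
  qed
  have "energy_bounds U L_mu L_nu r (compressed u)"
    if "u \<in> Lg L_lam" "r \<ge> 0" "energy_bounds V Wj Wk r (\<YY> (\<phi>_lam u))" for u r
    using compressed_energy_bounds[of r u] that by (simp add: \<Phi>1)
  then show ?thesis using Hom compressed_intertwining Psi_T by blast
qed

end
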